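(* Let $N\ge 3$ and $\mu\in(0,N)$. There exist constants $K=K(N,\mu)>0$ and $L=L(N,\mu)>0$ such that for every $u\in\mathcal{D}^{1,2}(\mathbb{R}^N)$ and every $v\in\widetilde{\mathcal{M}}$ with $\|u\|_{NL}=\|v\|_{NL}$, $$\|\nabla u-\nabla v\|_{L^2}^2\le K\,\widetilde\delta(u)+L\,\|u\|_{NL}\,\|u-v\|_{NL},$$ where $\widetilde\delta(u):=\int_{\mathbb{R}^N}|\nabla u|^2\,dx-S_{HL}\Big(\int_{\mathbb{R}^N}\big(|x|^{-\mu}\ast|u|^{2^*_\mu}\big)|u|^{2^*_\mu}\,dx\Big)^{1/2^*_\mu}$.
   Context: $2^*_\mu=\frac{2N-\mu}{N-2}$. $\mathcal{D}^{1,2}(\mathbb{R}^N)$ is the completion of $C_c^\infty(\mathbb{R}^N)$ under $\|\nabla u\|_{L^2}$. For measurable $u$, $\|u\|_{NL}:=\Big(\int_{\mathbb{R}^N}\big(|x|^{-\mu}\ast|u|^{2^*_\mu}\big)|u|^{2^*_\mu}dx\Big)^{\frac{1}{2\cdot 2^*_\mu}}$. $S_{HL}=S_{HL}(N,\mu)$ is the optimal (largest) constant in the nonlocal Sobolev inequality $S_{HL}\big(\int_{\mathbb{R}^N}(|x|^{-\mu}\ast|u|^{2^*_\mu})|u|^{2^*_\mu}dx\big)^{1/2^*_\mu}\le\int_{\mathbb{R}^N}|\nabla u|^2dx$ for all $u\in\mathcal{D}^{1,2}(\mathbb{R}^N)$. For $\xi\in\mathbb{R}^N,\lambda>0$, $W[\xi,\lambda](x)=c_{N,\mu}\big(\frac{\lambda}{1+\lambda^2|x-\xi|^2}\big)^{\frac{N-2}{2}}$,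 where $c_{N,\mu}>0$ is the unique constant for which $W[\xi,\lambda]$ solves $\Delta u+(|x|^{-\mu}\ast|u|^{2^*_\mu})|u|^{2^*_\mu-2}u=0$ in $\mathbb{R}^N$ ("Talenti bubble"). $\widetilde{\mathcal{M}}=\{cW[\xi,\lambda]: c\in\mathbb{R},\ \xi\in\mathbb{R}^N,\ \lambda>0\}$. *)

theory Defs
  imports "HOL-Analysis.Analysis"
begin

definition dimN :: "'n::finite itself \<Rightarrow> real" where
  "dimN _ = real CARD('n)"

definition sob_exp :: "'n::finite itself \<Rightarrow> real" where
  "sob_exp T = 2 * dimN T / (dimN T - 2)"

definition hls_exp :: "'n::finite itself \<Rightarrow> real \<Rightarrow> real" where
  "hls_exp T \<mu> = (2 * dimN T - \<mu>) / (dimN T - 2)"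

definition grad :: "(real^'n \<Rightarrow> real) \<Rightarrow> real^'n \<Rightarrow> real^'n" where
  "grad f x = (\<chi> i. frechet_derivative f (at x) (axis i 1))"

definition laplacian :: "(real^'n \<Rightarrow> real) \<Rightarrow> real^'n \<Rightarrow> real" where
  "laplacian f x = (\<Sum>i\<in>UNIV. frechet_derivative (\<lambda>y. grad f y $ i) (at x) (axis i 1))"

fun Ck :: "nat \<Rightarrow> (real^'n \<Rightarrow> real) \<Rightarrow> bool" where
  "Ck 0 f = continuous_on UNIV f"
| "Ck (Suc k) f = ((\<forall>x. f differentiable (at x)) \<and> (\<forall>i. Ck k (\<lambda>x. grad f x $ i)))"

definition smooth_cs :: "(real^'n \<Rightarrow> real) \<Rightarrow> bool" where
  "smooth_cs f \<longleftrightarrow> (\<forall>k. Ck k f) \<and> bounded {x. f x \<noteq> 0}"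

text \<open>\<open>D12 u G\<close>: u is an element of the completion of C_c^\<infinity> under the gradient
  L^2 norm (realized, via the Sobolev embedding, as the L^{2^*}-limit of an
  approximating sequence) and G is its (weak) gradient, the L^2-limit of the gradients.\<close>
definition D12 :: "(real^'n \<Rightarrow> real) \<Rightarrow> (real^'n \<Rightarrow> real^'n) \<Rightarrow> bool" where
  "D12 u G \<longleftrightarrow> u \<in> borel_measurable lborel \<and> G \<in> borel_measurable lborel \<and>
     (\<exists>\<phi>::nat \<Rightarrow> real^'n \<Rightarrow> real. (\<forall>k. smooth_cs (\<phi> k)) \<and>
        (\<lambda>k. \<integral>\<^sup>+ x. ennreal ((norm (grad (\<phi> k) x - G x))\<^sup>2) \<partial>lborel) \<longlonglongrightarrow> 0 \<and>
        (\<lambda>k. \<integral>\<^sup>+ x. ennreal (\<bar>\<phi> k x - u x\<bar> powr sob_exp TYPE('n)) \<partial>lborel) \<longlonglongrightarrow> 0)"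

definition NL_energy :: "real \<Rightarrow> (real^'n \<Rightarrow> real) \<Rightarrow> real" where
  "NL_energy \<mu> u = enn2real (\<integral>\<^sup>+ x. \<integral>\<^sup>+ y.
     ennreal (norm (x - y) powr (-\<mu>) * \<bar>u y\<bar> powr hls_exp TYPE('n) \<mu> * \<bar>u x\<bar> powr hls_exp TYPE('n) \<mu>)
       \<partial>lborel \<partial>lborel)"

definition NL_norm :: "real \<Rightarrow> (real^'n \<Rightarrow> real) \<Rightarrow> real" where
  "NL_norm \<mu> u = NL_energy \<mu> u powr (1 / (2 * hls_exp TYPE('n) \<mu>))"

definition S_HL :: "'n::finite itself \<Rightarrow> real \<Rightarrow> real" where
  "S_HL T \<mu> = Sup {S. \<forall>(u::real^'n \<Rightarrow> real) G. D12 u G \<longrightarrow>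
       S * NL_energy \<mu> u powr (1 / hls_exp TYPE('n) \<mu>) \<le> (\<integral>x. (norm (G x))\<^sup>2 \<partial>lborel)}"

definition delta_tilde :: "real \<Rightarrow> (real^'n \<Rightarrow> real) \<Rightarrow> (real^'n \<Rightarrow> real^'n) \<Rightarrow> real" where
  "delta_tilde \<mu> u G = (\<integral>x. (norm (G x))\<^sup>2 \<partial>lborel)
     - S_HL TYPE('n) \<mu> * NL_energy \<mu> u powr (1 / hls_exp TYPE('n) \<mu>)"

definition bubble_profile :: "real^'n \<Rightarrow> real \<Rightarrow> real^'n \<Rightarrow> real" where
  "bubble_profile \<xi> lam x = (lam / (1 + lam\<^sup>2 * (norm (x - \<xi>))\<^sup>2)) powr ((dimN TYPE('n) - 2) / 2)"

definition solves_choquard :: "real \<Rightarrow> (real^'n \<Rightarrow> real) \<Rightarrow> bool" where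
  "solves_choquard \<mu> f \<longleftrightarrow> (\<forall>k. Ck k f) \<and> (\<forall>x.
     laplacian f x + (\<integral>y. norm (x - y) powr (-\<mu>) * \<bar>f y\<bar> powr hls_exp TYPE('n) \<mu> \<partial>lborel)
        * \<bar>f x\<bar> powr (hls_exp TYPE('n) \<mu> - 2) * f x = 0)"

definition c_Nmu :: "'n::finite itself \<Rightarrow> real \<Rightarrow> real" where
  "c_Nmu T \<mu> = (THE c. c > 0 \<and>
     (\<forall>\<xi> (lam::real). lam > 0 \<longrightarrow> solves_choquard \<mu> (\<lambda>x::real^'n. c * bubble_profile \<xi> lam x)))"

definition W :: "real \<Rightarrow> real^'n \<Rightarrow> real \<Rightarrow> real^'n \<Rightarrow> real" where
  "W \<mu> \<xi> lam x = c_Nmu TYPE('n) \<mu> * bubble_profile \<xi> lam x"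

definition M_tilde :: "real \<Rightarrow> (real^'n \<Rightarrow> real) set" where
  "M_tilde \<mu> = {(\<lambda>x. c * W \<mu> \<xi> lam x) | c \<xi> lam. lam > 0}"

end

(*
  For v = c U with U a bubble, expanding the square gives
    |G - grad v|^2 = |G|^2 - |grad v|^2 - 2 c <G - grad v, grad U>   (in L^2).
  Since v lies in D^{1,2}, the Sobolev quotient bounds |grad v|^2 below by S_HL |v|_NL^2 = S_HL |u|_NL^2,
  so the first two terms are at most the deficit of u and K = 1 works. By Green's identity the last
  pairing is the integral of w (Delta U) with w = u - v, where Delta U is a multiple of
  lam^((n+2)/2) Q^(-(n+2)/2), Q x = 1 + lam^2 |x - xi|^2 (bden below). As lam |x - y| <= (Q x Q y)^(1/2), the
  nonlocal energy of w dominates lam^mu (int |w|^p Q^(-mu/2))^2, and Hoelder's inequality bounds the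
  pairing by C |w|_NL, uniformly in xi and lam. The same lower bound applied to v gives |c| <= C |v|_NL.
  All energies involved are finite by the Hardy-Littlewood-Sobolev inequality, of which only the
  qualitative diagonal case is needed.
  Neither the extremality of the bubbles nor the value of the normalizing constant c_{N,mu} is involved.
*)
theory Submission
  imports Defs "HOL-Computational_Algebra.Polynomial"
begin

section \<open>Power weights\<close>

text \<open>The delicate point is uniformity in the centre and the scale of the bubble: the weight
  has to be divided between the two Hoelder factors so that each scales like a fixed power of lam,
  and the powers must cancel in the end. The encoding adds two obligations. The energy is a real
  number obtained through \<open>enn2real\<close>, so a bound by |w|_NL says nothing until the
  underlying integral is known to be finite. And D^{1,2} is given by approximating sequences, so
  placing a bubble in it takes explicit smooth functions of bounded support that converge in
  gradient and in the Sobolev norm at once. They arise by suppressing the small values of U with the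
  flat function exp(-1/y). In Green's identity the second derivatives fall on the bubble, which is
  smooth and explicit; u enters only through its approximants, and the pairing passes to the limit
  by Hoelder's inequality.\<close>

lemma power2_powr:
  fixes a :: real
  assumes "0 \<le> a"
  shows "(a\<^sup>2) powr b = a powr (2 * b)"
proof (cases "a = 0")
  case False
  then have "a powr 2 = a\<^sup>2" using assms by (simp add: powr_numeral)
  then show ?thesis by (simp flip: powr_powr)
qed simp

lemma term_le_suminf_ennreal:
  fixes f :: "nat \<Rightarrow> ennreal"
  shows "f k \<le> (\<Sum>k. f k)"
  using sum_le_suminf[of f "{k}"] by simp

text \<open>Dyadic shells: between the radii \<open>r (Suc k)\<close> and \<open>r k\<close> the
  kernel is at most \<open>r (Suc k) powr (-\<mu>)\<close> and the volume at most that of the outer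
  ball, so the contributions form a geometric series of ratio 2^(\<mu> - n) < 1. Taking the kernel
  at the inner radius costs the factor 2^\<mu> in \<open>C\<close>. The centre contributes nothing,
  as \<open>0 powr (-\<mu>)\<close> is 0.\<close>

lemma nn_integral_near_powr:
  assumes "0 < \<mu>" "\<mu> < real DIM('a::euclidean_space)"
  shows "\<exists>C>0. \<forall>(y::'a) R. R > 0 \<longrightarrow>
    (\<integral>\<^sup>+x. ennreal (norm (x - y) powr (-\<mu>)) * indicator (ball y R) x \<partial>lborel)
      \<le> ennreal (C * R powr (real DIM('a) - \<mu>))"
proof -
  let ?n = "real DIM('a)"
  let ?q = "2 powr (\<mu> - ?n)"
  have q: "0 < ?q" "?q < 1" using assms by (auto simp: powr_less_one)
  define C where "C = unit_ball_vol ?n * 2 powr \<mu> / (1 - ?q)"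
  have Cpos: "C > 0" unfolding C_def using q by auto
  have main: "(\<integral>\<^sup>+x. ennreal (norm (x - y) powr (-\<mu>)) * indicator (ball y R) x \<partial>lborel)
      \<le> ennreal (C * R powr (?n - \<mu>))" if R: "R > 0" for y :: 'a and R
  proof -
    define r where "r k = R * 2 powr (- real k)" for k :: nat
    have rpos: "r k > 0" for k using R by (simp add: r_def)
    have pt: "ennreal (norm (x - y) powr (-\<mu>)) * indicator (ball y R) x
        \<le> (\<Sum>k. ennreal ((r (Suc k)) powr (-\<mu>)) * indicator (ball y (r k)) x)" for x
    proof (cases "x \<in> ball y R \<and> x \<noteq> y")
      case True
      then have d: "0 < norm (x - y)" "norm (x - y) < R" by (auto simp: dist_norm norm_minus_commute)
      define t where "t = log 2 (R / norm (x - y))"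
      have t: "t > 0" using d R unfolding t_def by (subst zero_less_log_cancel_iff) (simp_all add: field_simps)
      \<comment> \<open>This gives \<open>real k < t\<close> and
        \<open>t \<le> real (Suc k)\<close>; the outer inequality must be strict because the
        indicators are those of open balls.\<close>
      define k where "k = nat (\<lceil>t\<rceil> - 1)"
      have k: "real k < t" "t \<le> real (Suc k)" using t unfolding k_def by linarith+
      have e: "2 powr t = R / norm (x - y)" unfolding t_def using d R by simp
      have nx: "norm (x - y) = R * 2 powr (-t)"
        using e d R by (simp add: powr_minus field_simps)
      have 1: "norm (x - y) < r k" unfolding nx r_def using k R by simp
      have 2: "r (Suc k) \<le> norm (x - y)" unfolding nx r_def using k R by simp
      have "norm (x - y) powr (-\<mu>) \<le> r (Suc k) powr (-\<mu>)"
        using 2 rpos assms by (intro powr_mono2') auto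
      then have "ennreal (norm (x - y) powr (-\<mu>)) * indicator (ball y R) x
         \<le> ennreal ((r (Suc k)) powr (-\<mu>)) * indicator (ball y (r k)) x"
        using 1 True by (auto simp: dist_norm norm_minus_commute)
      also have "\<dots> \<le> (\<Sum>k. ennreal ((r (Suc k)) powr (-\<mu>)) * indicator (ball y (r k)) x)"
        by (rule term_le_suminf_ennreal)
      finally show ?thesis .
    next
      case False
      then show ?thesis by auto
    qed
    have term_eq: "ennreal ((r (Suc k)) powr (-\<mu>)) * emeasure lborel (ball y (r k))
        = ennreal (unit_ball_vol ?n * 2 powr \<mu> * R powr (?n - \<mu>)) * ennreal (?q ^ k)" for k
    proof -
      have 1: "(r (Suc k)) powr (-\<mu>) = R powr (-\<mu>) * 2 powr (\<mu> * real (Suc k))"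
        using R unfolding r_def by (simp add: powr_mult powr_powr algebra_simps)
      have "r k ^ DIM('a) = r k powr ?n" using rpos by (simp add: powr_realpow)
      then have 2: "r k ^ DIM('a) = R powr ?n * 2 powr (- real k * ?n)"
        using R unfolding r_def by (simp add: powr_mult powr_powr)
      have 3: "?q ^ k = 2 powr ((\<mu> - ?n) * real k)"
        by (simp add: powr_realpow flip: powr_powr)
      have 4: "2 powr (\<mu> * real (Suc k)) * 2 powr (- real k * ?n) = 2 powr \<mu> * 2 powr ((\<mu> - ?n) * real k)"
        by (simp add: powr_add[symmetric] algebra_simps)
      have "(r (Suc k)) powr (-\<mu>) * (unit_ball_vol ?n * r k ^ DIM('a))
        = unit_ball_vol ?n * (R powr (-\<mu>) * R powr ?n) * (2 powr (\<mu> * real (Suc k)) * 2 powr (- real k * ?n))"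
        unfolding 1 2 by (simp only: mult_ac)
      also have "R powr (-\<mu>) * R powr ?n = R powr (?n - \<mu>)"
        by (simp add: powr_add[symmetric])
      finally have "(r (Suc k)) powr (-\<mu>) * (unit_ball_vol ?n * r k ^ DIM('a))
        = (unit_ball_vol ?n * 2 powr \<mu> * R powr (?n - \<mu>)) * ?q ^ k"
        unfolding 3 4 by (simp only: mult_ac)
      then show ?thesis
        using rpos[of k] by (simp add: emeasure_ball ennreal_mult'[symmetric] less_imp_le)
    qed
    have "(\<integral>\<^sup>+x. ennreal (norm (x - y) powr (-\<mu>)) * indicator (ball y R) x \<partial>lborel)
      \<le> (\<integral>\<^sup>+x. (\<Sum>k. ennreal ((r (Suc k)) powr (-\<mu>)) * indicator (ball y (r k)) x) \<partial>lborel)"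
      by (rule nn_integral_mono) (rule pt)
    also have "\<dots> = (\<Sum>k. ennreal ((r (Suc k)) powr (-\<mu>)) * emeasure lborel (ball y (r k)))"
    proof -
      have "(\<integral>\<^sup>+x. (\<Sum>k. ennreal ((r (Suc k)) powr (-\<mu>)) * indicator (ball y (r k)) x) \<partial>lborel)
        = (\<Sum>k. \<integral>\<^sup>+x. ennreal ((r (Suc k)) powr (-\<mu>)) * indicator (ball y (r k)) x \<partial>lborel)"
        by (intro nn_integral_suminf borel_measurable_times_ennreal borel_measurable_const
            borel_measurable_indicator) simp
      then show ?thesis by (simp only: nn_integral_cmult_indicator sets_lborel borel_open open_ball)
    qed
    also have "\<dots> = ennreal (unit_ball_vol ?n * 2 powr \<mu> * R powr (?n - \<mu>)) * (\<Sum>k. ennreal (?q ^ k))"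
      by (simp only: term_eq ennreal_suminf_cmult)
    also have "(\<Sum>k. ennreal (?q ^ k)) = ennreal (1 / (1 - ?q))"
      using q by (subst suminf_ennreal2) (auto simp: suminf_geometric summable_geometric)
    also have "ennreal (unit_ball_vol ?n * 2 powr \<mu> * R powr (?n - \<mu>)) * ennreal (1 / (1 - ?q))
      = ennreal (C * R powr (?n - \<mu>))"
      using q by (subst ennreal_mult'[symmetric]) (auto simp: C_def)
    finally show ?thesis .
  qed
  show ?thesis using Cpos main by blast
qed

text \<open>The same series with doubling radii: shell k carries a multiple of 2^(k(n - b)),
  summable since b > n. The kernel is taken at the inner radius and the volume at the outer one,
  whence the factor 2^n in \<open>C\<close>.\<close>

lemma nn_integral_far_powr:
  assumes "real DIM('a::euclidean_space) < b"
  shows "\<exists>C>0. \<forall>(y::'a) R. R > 0 \<longrightarrow>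
    (\<integral>\<^sup>+x. ennreal (norm (x - y) powr (-b)) * indicator (- ball y R) x \<partial>lborel)
      \<le> ennreal (C * R powr (real DIM('a) - b))"
proof -
  let ?n = "real DIM('a)"
  let ?q = "2 powr (?n - b)"
  have q: "0 < ?q" "?q < 1" using assms by (auto simp: powr_less_one)
  have b0: "b > 0" using assms by (rule le_less_trans[rotated]) simp
  define C where "C = unit_ball_vol ?n * 2 powr ?n / (1 - ?q)"
  have Cpos: "C > 0" unfolding C_def using q by auto
  have main: "(\<integral>\<^sup>+x. ennreal (norm (x - y) powr (-b)) * indicator (- ball y R) x \<partial>lborel)
      \<le> ennreal (C * R powr (?n - b))" if R: "R > 0" for y :: 'a and R
  proof -
    define r where "r k = R * 2 powr (real k)" for k :: nat
    have rpos: "r k > 0" for k using R by (simp add: r_def)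
    have pt: "ennreal (norm (x - y) powr (-b)) * indicator (- ball y R) x
        \<le> (\<Sum>k. ennreal ((r k) powr (-b)) * indicator (ball y (r (Suc k))) x)" for x
    proof (cases "x \<in> ball y R")
      case False
      then have d: "R \<le> norm (x - y)" by (auto simp: dist_norm norm_minus_commute)
      then have d0: "norm (x - y) > 0" using R by linarith
      define t where "t = log 2 (norm (x - y) / R)"
      have t: "t \<ge> 0" using d d0 R unfolding t_def by (subst zero_le_log_cancel_iff) (simp_all add: field_simps)
      define k where "k = nat \<lfloor>t\<rfloor>"
      have k: "real k \<le> t" "t < real (Suc k)" using t unfolding k_def by linarith+
      have nx: "norm (x - y) = R * 2 powr t" unfolding t_def using d0 R by simp
      have 1: "norm (x - y) < r (Suc k)" unfolding nx r_def using k R by simp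
      have 2: "r k \<le> norm (x - y)" unfolding nx r_def using k R by simp
      have "norm (x - y) powr (-b) \<le> r k powr (-b)"
        using 2 rpos b0 by (intro powr_mono2') auto
      then have "ennreal (norm (x - y) powr (-b)) * indicator (- ball y R) x
         \<le> ennreal ((r k) powr (-b)) * indicator (ball y (r (Suc k))) x"
        using 1 False by (auto simp: dist_norm norm_minus_commute)
      also have "\<dots> \<le> (\<Sum>k. ennreal ((r k) powr (-b)) * indicator (ball y (r (Suc k))) x)"
        by (rule term_le_suminf_ennreal)
      finally show ?thesis .
    next
      case True
      then show ?thesis by auto
    qed
    have term_eq: "ennreal ((r k) powr (-b)) * emeasure lborel (ball y (r (Suc k)))
        = ennreal (unit_ball_vol ?n * 2 powr ?n * R powr (?n - b)) * ennreal (?q ^ k)" for k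
    proof -
      have 1: "(r k) powr (-b) = R powr (-b) * 2 powr (- b * real k)"
        using R unfolding r_def by (simp add: powr_mult powr_powr mult_ac)
      have "r (Suc k) ^ DIM('a) = r (Suc k) powr ?n" using rpos by (simp add: powr_realpow)
      then have 2: "r (Suc k) ^ DIM('a) = R powr ?n * 2 powr (real (Suc k) * ?n)"
        using R unfolding r_def by (simp add: powr_mult powr_powr)
      have 3: "?q ^ k = 2 powr ((?n - b) * real k)"
        by (simp add: powr_realpow flip: powr_powr)
      have 4: "2 powr (- b * real k) * 2 powr (real (Suc k) * ?n) = 2 powr ?n * 2 powr ((?n - b) * real k)"
        by (simp add: powr_add[symmetric] algebra_simps)
      have "(r k) powr (-b) * (unit_ball_vol ?n * r (Suc k) ^ DIM('a))
        = unit_ball_vol ?n * (R powr (-b) * R powr ?n) * (2 powr (- b * real k) * 2 powr (real (Suc k) * ?n))"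
        unfolding 1 2 by (simp only: mult_ac)
      also have "R powr (-b) * R powr ?n = R powr (?n - b)"
        by (simp add: powr_add[symmetric])
      finally have "(r k) powr (-b) * (unit_ball_vol ?n * r (Suc k) ^ DIM('a))
        = (unit_ball_vol ?n * 2 powr ?n * R powr (?n - b)) * ?q ^ k"
        unfolding 3 4 by (simp only: mult_ac)
      then show ?thesis
        using rpos[of "Suc k"] by (simp add: emeasure_ball ennreal_mult'[symmetric] less_imp_le)
    qed
    have "(\<integral>\<^sup>+x. ennreal (norm (x - y) powr (-b)) * indicator (- ball y R) x \<partial>lborel)
      \<le> (\<integral>\<^sup>+x. (\<Sum>k. ennreal ((r k) powr (-b)) * indicator (ball y (r (Suc k))) x) \<partial>lborel)"
      by (rule nn_integral_mono) (rule pt)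
    also have "\<dots> = (\<Sum>k. ennreal ((r k) powr (-b)) * emeasure lborel (ball y (r (Suc k))))"
    proof -
      have "(\<integral>\<^sup>+x. (\<Sum>k. ennreal ((r k) powr (-b)) * indicator (ball y (r (Suc k))) x) \<partial>lborel)
        = (\<Sum>k. \<integral>\<^sup>+x. ennreal ((r k) powr (-b)) * indicator (ball y (r (Suc k))) x \<partial>lborel)"
        by (intro nn_integral_suminf borel_measurable_times_ennreal borel_measurable_const
            borel_measurable_indicator) simp
      then show ?thesis by (simp only: nn_integral_cmult_indicator sets_lborel borel_open open_ball)
    qed
    also have "\<dots> = ennreal (unit_ball_vol ?n * 2 powr ?n * R powr (?n - b)) * (\<Sum>k. ennreal (?q ^ k))"
      by (simp only: term_eq ennreal_suminf_cmult)
    also have "(\<Sum>k. ennreal (?q ^ k)) = ennreal (1 / (1 - ?q))"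
      using q by (subst suminf_ennreal2) (auto simp: suminf_geometric summable_geometric)
    also have "ennreal (unit_ball_vol ?n * 2 powr ?n * R powr (?n - b)) * ennreal (1 / (1 - ?q))
      = ennreal (C * R powr (?n - b))"
      using q by (subst ennreal_mult'[symmetric]) (auto simp: C_def)
    finally show ?thesis .
  qed
  show ?thesis using Cpos main by blast
qed

section \<open>Integrals of powers of the bubble denominator\<close>

definition bden :: "'a::real_normed_vector \<Rightarrow> real \<Rightarrow> 'a \<Rightarrow> real" where
  "bden \<xi> lam x = 1 + lam\<^sup>2 * (norm (x - \<xi>))\<^sup>2"

lemma bden_ge_1: "bden \<xi> lam x \<ge> 1"
  by (simp add: bden_def)

lemma bden_pos: "bden \<xi> lam x > 0"
  using bden_ge_1[of \<xi> lam x] by linarith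

lemma borel_measurable_bden [measurable]: "bden \<xi> lam \<in> borel_measurable borel"
  unfolding bden_def by (intro borel_measurable_continuous_onI continuous_intros)

text \<open>The split at radius 1/lam is where the two terms of Q balance. Inside, Q \<ge> 1 leaves
  the volume of the ball; outside, Q dominates \<open>(lam * norm (x - \<xi>))\<^sup>2\<close> and
  \<open>nn_integral_far_powr\<close> applies with exponent 2b. Both parts scale like
  lam^(-n).\<close>

lemma nn_integral_bden_powr:
  assumes "real DIM('a::euclidean_space) < 2 * b"
  shows "\<exists>C>0. \<forall>(\<xi>::'a) lam. lam > 0 \<longrightarrow>
    (\<integral>\<^sup>+x. ennreal (bden \<xi> lam x powr (-b)) \<partial>lborel) \<le> ennreal (C * lam powr (- real DIM('a)))"
proof -
  let ?n = "real DIM('a)"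
  obtain C where C: "C > 0" and bd: "\<And>(y::'a) R. R > 0 \<Longrightarrow>
    (\<integral>\<^sup>+x. ennreal (norm (x - y) powr (-(2*b))) * indicator (- ball y R) x \<partial>lborel)
      \<le> ennreal (C * R powr (?n - 2*b))"
    using nn_integral_far_powr[where 'a = 'a and b = "2*b"] assms by blast
  have b0: "b > 0" using assms of_nat_0_le_iff[of "DIM('a)", where 'a = real] by linarith
  define D where "D = unit_ball_vol ?n + C"
  have "(\<integral>\<^sup>+x. ennreal (bden \<xi> lam x powr (-b)) \<partial>lborel) \<le> ennreal (D * lam powr (- ?n))"
    if lam: "lam > 0" for \<xi> :: 'a and lam
  proof -
    have pt: "ennreal (bden \<xi> lam x powr (-b)) \<le> indicator (ball \<xi> (1/lam)) x
       + ennreal (lam powr (-(2*b))) * (ennreal (norm (x - \<xi>) powr (-(2*b))) * indicator (- ball \<xi> (1/lam)) x)" for x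
    proof (cases "x \<in> ball \<xi> (1/lam)")
      case True
      have "bden \<xi> lam x powr (-b) \<le> 1"
        using bden_ge_1[of \<xi> lam x] b0 powr_mono2'[of "-b" 1 "bden \<xi> lam x"] by simp
      then show ?thesis using True by simp
    next
      case False
      then have d: "1/lam \<le> norm (x - \<xi>)" by (auto simp: dist_norm norm_minus_commute)
      then have d0: "norm (x - \<xi>) > 0" using lam by (intro less_le_trans[OF _ d]) simp
      have "bden \<xi> lam x powr (-b) \<le> ((lam * norm (x - \<xi>))\<^sup>2) powr (-b)"
        using b0 lam d0 by (intro powr_mono2') (auto simp: bden_def power_mult_distrib)
      also have "\<dots> = (lam * norm (x - \<xi>)) powr (-(2*b))"
        using lam by (simp add: power2_powr)
      also have "\<dots> = lam powr (-(2*b)) * norm (x - \<xi>) powr (-(2*b))"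
        using lam by (simp add: powr_mult)
      finally show ?thesis using False by (simp add: ennreal_mult'[symmetric])
    qed
    have "(\<integral>\<^sup>+x. ennreal (bden \<xi> lam x powr (-b)) \<partial>lborel) \<le>
      (\<integral>\<^sup>+x. indicator (ball \<xi> (1/lam)) x
       + ennreal (lam powr (-(2*b))) * (ennreal (norm (x - \<xi>) powr (-(2*b))) * indicator (- ball \<xi> (1/lam)) x) \<partial>lborel)"
      by (rule nn_integral_mono) (rule pt)
    also have "\<dots> = emeasure lborel (ball \<xi> (1/lam)) + ennreal (lam powr (-(2*b))) *
       (\<integral>\<^sup>+x. ennreal (norm (x - \<xi>) powr (-(2*b))) * indicator (- ball \<xi> (1/lam)) x \<partial>lborel)"
      by (subst nn_integral_add) (auto simp: nn_integral_cmult intro!: borel_measurable_indicator borel_open)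
    also have "\<dots> \<le> emeasure lborel (ball \<xi> (1/lam)) + ennreal (lam powr (-(2*b))) *
       ennreal (C * (1/lam) powr (?n - 2*b))"
      using lam by (intro add_left_mono mult_left_mono bd) auto
    also have "\<dots> = ennreal (D * lam powr (- ?n))"
    proof -
      have "(1/lam)^DIM('a) = lam powr (- ?n)"
        using lam by (simp add: powr_minus_divide powr_realpow power_one_over)
      moreover have "lam powr (-(2*b)) * (C * (1/lam) powr (?n - 2*b)) = C * lam powr (- ?n)"
        using lam by (simp add: powr_divide powr_diff powr_minus_divide)
      ultimately show ?thesis
        using lam C by (simp add: emeasure_ball ennreal_mult'[symmetric] ennreal_plus[symmetric] D_def algebra_simps
           del: ennreal_plus)
    qed
    finally show ?thesis .
  qed
  moreover have "D > 0" using C by (simp add: D_def add_pos_pos)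
  ultimately show ?thesis by blast
qed

section \<open>A diagonal Hardy--Littlewood--Sobolev estimate\<close>

text \<open>Young's inequality for f / A^(1/p) and g / B^(1/q), multiplied by D = A^(1/p) B^(1/q)
  and integrated, gives D (1/p + 1/q) = D. The integrals enter through real upper bounds A and B, so
  that estimates can be plugged in directly. The normalization divides by A and B; if one of them is
  0, the product vanishes almost everywhere.\<close>

lemma nn_integral_Holder:
  fixes f g :: "'a \<Rightarrow> real"
  assumes [measurable]: "f \<in> borel_measurable M" "g \<in> borel_measurable M"
    and nonneg: "\<And>x. f x \<ge> 0" "\<And>x. g x \<ge> 0"
    and pq: "p > 1" "q > 1" "1 / p + 1 / q = 1"
    and AB: "A \<ge> 0" "B \<ge> 0"
    and fA: "(\<integral>\<^sup>+x. ennreal (f x powr p) \<partial>M) \<le> ennreal A"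
    and gB: "(\<integral>\<^sup>+x. ennreal (g x powr q) \<partial>M) \<le> ennreal B"
  shows "(\<integral>\<^sup>+x. ennreal (f x * g x) \<partial>M) \<le> ennreal (A powr (1/p) * B powr (1/q))"
proof (cases "A = 0 \<or> B = 0")
  case True
  have "AE x in M. f x * g x = 0"
  proof (cases "A = 0")
    case True
    then have "(\<integral>\<^sup>+x. ennreal (f x powr p) \<partial>M) = 0" using fA by simp
    then have "AE x in M. ennreal (f x powr p) = 0" by (subst (asm) nn_integral_0_iff_AE) auto
    then show ?thesis by eventually_elim auto
  next
    case False
    then have "(\<integral>\<^sup>+x. ennreal (g x powr q) \<partial>M) = 0" using gB \<open>A = 0 \<or> B = 0\<close> by simp
    then have "AE x in M. ennreal (g x powr q) = 0" by (subst (asm) nn_integral_0_iff_AE) auto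
    then show ?thesis by eventually_elim auto
  qed
  then have "(\<integral>\<^sup>+x. ennreal (f x * g x) \<partial>M) = (\<integral>\<^sup>+x. 0 \<partial>M)"
    by (intro nn_integral_cong_AE) auto
  then show ?thesis by simp
next
  case False
  then have A: "A > 0" and B: "B > 0" using AB by auto
  define D where "D = A powr (1/p) * B powr (1/q)"
  have D: "D > 0" using A B by (simp add: D_def)
  have pt: "ennreal (f x * g x) \<le> ennreal (D / (A * p)) * ennreal (f x powr p) + ennreal (D / (B * q)) * ennreal (g x powr q)" for x
  proof -
    have "f x / A powr (1/p) * (g x / B powr (1/q))
      \<le> (f x / A powr (1/p)) powr p / p + (g x / B powr (1/q)) powr q / q"
      using nonneg pq by (intro Youngs_inequality) auto
    also have "\<dots> = f x powr p / (A * p) + g x powr q / (B * q)"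
      using nonneg A B pq by (simp add: powr_divide powr_powr)
    finally have "D * (f x / A powr (1/p) * (g x / B powr (1/q)))
       \<le> D * (f x powr p / (A * p) + g x powr q / (B * q))"
      using D by (intro mult_left_mono) auto
    moreover have "D * (f x / A powr (1/p) * (g x / B powr (1/q))) = f x * g x"
      using A B by (simp add: D_def field_simps)
    ultimately have "f x * g x \<le> D / (A * p) * f x powr p + D / (B * q) * g x powr q"
      by (simp add: distrib_left)
    then show ?thesis using A B D pq
      by (simp add: ennreal_mult'[symmetric] ennreal_plus[symmetric] ennreal_leI del: ennreal_plus)
  qed
  have "(\<integral>\<^sup>+x. ennreal (f x * g x) \<partial>M)
     \<le> (\<integral>\<^sup>+x. ennreal (D / (A * p)) * ennreal (f x powr p) + ennreal (D / (B * q)) * ennreal (g x powr q) \<partial>M)"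
    by (rule nn_integral_mono) (rule pt)
  also have "\<dots> = ennreal (D / (A * p)) * (\<integral>\<^sup>+x. ennreal (f x powr p) \<partial>M)
      + ennreal (D / (B * q)) * (\<integral>\<^sup>+x. ennreal (g x powr q) \<partial>M)"
    by (simp add: nn_integral_add nn_integral_cmult)
  also have "\<dots> \<le> ennreal (D / (A * p)) * ennreal A + ennreal (D / (B * q)) * ennreal B"
    by (intro add_mono mult_left_mono fA gB) auto
  also have "\<dots> = ennreal (D / (A * p) * A + D / (B * q) * B)"
    using A B D pq by (simp add: ennreal_mult'[symmetric] ennreal_plus[symmetric] del: ennreal_plus)
  also have "D / (A * p) * A + D / (B * q) * B = D * (1 / p + 1 / q)"
    using A B by (simp add: field_simps)
  finally show ?thesis using pq by (simp add: D_def)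
qed

text \<open>Within distance R of x, f is replaced by its bound b and the kernel is integrable
  because \<mu> < n. Beyond R, Young's inequality with exponents r and s = 2n/\<mu> turns the kernel
  into |x - y|^(-2n), which is integrable there. \<open>C\<close> depends on f through the integral
  \<open>A\<close>, so this serves finiteness and not an inequality with a universal
  constant.\<close>

lemma riesz_potential_sublevel_bound:
  fixes f :: "'a::euclidean_space \<Rightarrow> real"
  assumes [measurable]: "f \<in> borel_measurable borel" and nonneg: "\<And>x. f x \<ge> 0"
    and mu: "0 < \<mu>" "\<mu> < real DIM('a)"
    and r: "r = 2 * real DIM('a) / (2 * real DIM('a) - \<mu>)"
    and fin: "(\<integral>\<^sup>+x. ennreal (f x powr r) \<partial>lborel) < \<infinity>"
  shows "\<exists>C>0. \<forall>x b. b > 0 \<longrightarrow>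
    (\<integral>\<^sup>+y. ennreal (norm (x - y) powr (-\<mu>) * f y) * indicator {y. f y \<le> b} y \<partial>lborel)
      \<le> ennreal (C * b powr (r - 1))"
proof -
  let ?n = "real DIM('a)"
  have n: "?n > 0" by simp
  have r1: "r > 1" unfolding r using mu n by (simp add: field_simps)
  define s where "s = 2 * ?n / \<mu>"
  have s1: "s > 1" using mu n by (simp add: s_def field_simps)
  have rs: "1 / r + 1 / s = 1" using mu n by (simp add: r s_def field_simps)
  define A where "A = enn2real (\<integral>\<^sup>+x. ennreal (f x powr r) \<partial>lborel)"
  have A: "(\<integral>\<^sup>+x. ennreal (f x powr r) \<partial>lborel) = ennreal A" "A \<ge> 0"
    using fin by (auto simp: A_def ennreal_enn2real_if)
  obtain C1 where C1: "C1 > 0" and near: "\<And>(y::'a) R. R > 0 \<Longrightarrow>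
    (\<integral>\<^sup>+x. ennreal (norm (x - y) powr (-\<mu>)) * indicator (ball y R) x \<partial>lborel)
      \<le> ennreal (C1 * R powr (?n - \<mu>))"
    using nn_integral_near_powr[OF mu] by blast
  obtain C2 where C2: "C2 > 0" and far: "\<And>(y::'a) R. R > 0 \<Longrightarrow>
    (\<integral>\<^sup>+x. ennreal (norm (x - y) powr (-(2 * ?n))) * indicator (- ball y R) x \<partial>lborel)
      \<le> ennreal (C2 * R powr (?n - 2 * ?n))"
    using nn_integral_far_powr[where 'a = 'a and b = "2 * ?n"] n by auto
  define C where "C = C1 + A + C2"
  have bound: "(\<integral>\<^sup>+y. ennreal (norm (x - y) powr (-\<mu>) * f y) * indicator {y. f y \<le> b} y \<partial>lborel)
      \<le> ennreal (C * b powr (r - 1))" if b: "b > 0" for x b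
  proof -
    \<comment> \<open>With this radius the near and the far part of the kernel contribute the same power of \<open>b\<close>.\<close>
    define R where "R = b powr (- 2 / (2 * ?n - \<mu>))"
    have R: "R > 0" using b by (simp add: R_def)
    have pt: "ennreal (norm (x - y) powr (-\<mu>) * f y) * indicator {y. f y \<le> b} y
       \<le> ennreal b * (ennreal (norm (y - x) powr (-\<mu>)) * indicator (ball x R) y)
        + (ennreal (b powr (r - 1)) * ennreal (f y powr r)
        + ennreal (1 / b) * (ennreal (norm (y - x) powr (-(2 * ?n))) * indicator (- ball x R) y))" for y
    proof (cases "f y \<le> b")
      case le: True
      show ?thesis
      proof (cases "y \<in> ball x R")
        case True
        have "ennreal (norm (x - y) powr (-\<mu>) * f y) \<le> ennreal (b * norm (y - x) powr (-\<mu>))"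
          using le by (intro ennreal_leI) (simp add: norm_minus_commute[of x y] mult.commute[of _ "f y"] mult_right_mono)
        then show ?thesis using True b le by (simp add: ennreal_mult' add_increasing2)
      next
        case False
        then have d0: "norm (y - x) > 0" using R by (auto simp: dist_norm norm_minus_commute)
        \<comment> \<open>The weight in Young's inequality: t^r = b^(r-1) and t^s = b, so the two
          terms become b^(r-1) f(y)^r and |x - y|^(-2n) / b.\<close>
        define t where "t = b powr ((r - 1) / r)"
        have t: "t > 0" using b by (simp add: t_def)
        have "(t * f y) * (norm (y - x) powr (-\<mu>) / t)
          \<le> (t * f y) powr r / r + (norm (y - x) powr (-\<mu>) / t) powr s / s"
          using nonneg r1 s1 rs t by (intro Youngs_inequality) auto
        also have "\<dots> \<le> (t * f y) powr r + (norm (y - x) powr (-\<mu>) / t) powr s"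
          using r1 s1 divide_left_mono[of 1 r "(t * f y) powr r"]
            divide_left_mono[of 1 s "(norm (y - x) powr (-\<mu>) / t) powr s"] by auto
        also have "(t * f y) powr r = b powr (r - 1) * f y powr r"
          using nonneg t r1 b by (simp add: powr_mult t_def powr_powr)
        also have "(norm (y - x) powr (-\<mu>) / t) powr s = 1 / b * norm (y - x) powr (-(2 * ?n))"
        proof -
          have "(norm (y - x) powr (-\<mu>)) powr s = norm (y - x) powr (-(2 * ?n))"
            using mu by (simp add: powr_powr s_def)
          moreover have "(r - 1) / r * s = 1" using mu n by (simp add: r s_def field_simps)
          then have "t powr s = b" using b by (simp add: t_def powr_powr)
          ultimately show ?thesis using t by (simp add: powr_divide)
        qed
        also have "(t * f y) * (norm (y - x) powr (-\<mu>) / t) = norm (x - y) powr (-\<mu>) * f y"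
          using t by (simp add: norm_minus_commute)
        finally show ?thesis using False le b
          by (simp add: ennreal_mult'[symmetric] ennreal_plus[symmetric] ennreal_leI del: ennreal_plus)
      qed
    qed auto
    have "(\<integral>\<^sup>+y. ennreal (norm (x - y) powr (-\<mu>) * f y) * indicator {y. f y \<le> b} y \<partial>lborel)
      \<le> (\<integral>\<^sup>+y. ennreal b * (ennreal (norm (y - x) powr (-\<mu>)) * indicator (ball x R) y)
        + (ennreal (b powr (r - 1)) * ennreal (f y powr r)
        + ennreal (1 / b) * (ennreal (norm (y - x) powr (-(2 * ?n))) * indicator (- ball x R) y)) \<partial>lborel)"
      by (rule nn_integral_mono) (rule pt)
    also have "\<dots> = ennreal b * (\<integral>\<^sup>+y. ennreal (norm (y - x) powr (-\<mu>)) * indicator (ball x R) y \<partial>lborel)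
        + (ennreal (b powr (r - 1)) * ennreal A
        + ennreal (1 / b) * (\<integral>\<^sup>+y. ennreal (norm (y - x) powr (-(2 * ?n))) * indicator (- ball x R) y \<partial>lborel))"
    proof -
      have [measurable]: "ball x R \<in> sets borel" "- ball x R \<in> sets borel" by auto
      show ?thesis by (subst nn_integral_add nn_integral_cmult, measurable)+ (simp add: A)
    qed
    also have "\<dots> \<le> ennreal b * ennreal (C1 * R powr (?n - \<mu>)) + (ennreal (b powr (r - 1)) * ennreal A
        + ennreal (1 / b) * ennreal (C2 * R powr (?n - 2 * ?n)))"
      by (intro add_mono mult_left_mono near far R order_refl) auto
    also have "\<dots> = ennreal (C * b powr (r - 1))"
    proof -
      have 1: "b * R powr (?n - \<mu>) = b powr (r - 1)"
      proof -
        have "b * R powr (?n - \<mu>) = b powr (1 + (- 2 / (2 * ?n - \<mu>)) * (?n - \<mu>))"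
          using powr_one[of b] b by (simp only: R_def powr_powr powr_add)
        also have "1 + (- 2 / (2 * ?n - \<mu>)) * (?n - \<mu>) = r - 1" using mu by (simp add: r field_simps)
        finally show ?thesis .
      qed
      have 2: "1 / b * R powr (?n - 2 * ?n) = b powr (r - 1)"
      proof -
        have "1 / b * R powr (?n - 2 * ?n) = b powr (- 1 + (- 2 / (2 * ?n - \<mu>)) * (?n - 2 * ?n))"
          using powr_neg_one[of b] b by (simp only: R_def powr_powr powr_add)
        also have "- 1 + (- 2 / (2 * ?n - \<mu>)) * (?n - 2 * ?n) = r - 1" using mu by (simp add: r field_simps)
        finally show ?thesis .
      qed
      have "b * (C1 * R powr (?n - \<mu>)) + (b powr (r - 1) * A + 1 / b * (C2 * R powr (?n - 2 * ?n)))
        = C1 * (b * R powr (?n - \<mu>)) + b powr (r - 1) * A + C2 * (1 / b * R powr (?n - 2 * ?n))"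
        by (simp only: mult_ac add.assoc)
      also have "\<dots> = C * b powr (r - 1)" unfolding 1 2 C_def by (simp add: algebra_simps)
      finally show ?thesis using b C1 C2 A(2)
        by (simp add: ennreal_mult'[symmetric] ennreal_plus[symmetric] del: ennreal_plus)
    qed
    finally show ?thesis .
  qed
  have "C > 0" using C1 C2 A by (simp add: C_def)
  with bound show ?thesis by blast
qed

text \<open>By symmetry of the kernel it suffices to integrate over \<open>f y \<le> f x\<close>, where the inner
  integral is at most a multiple of \<open>f x powr (r - 1)\<close>.\<close>
lemma diagonal_HLS_finite:
  fixes f :: "'a::euclidean_space \<Rightarrow> real"
  assumes [measurable]: "f \<in> borel_measurable borel" and nonneg: "\<And>x. f x \<ge> 0"
    and mu: "0 < \<mu>" "\<mu> < real DIM('a)"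
    and fin: "(\<integral>\<^sup>+x. ennreal (f x powr (2 * real DIM('a) / (2 * real DIM('a) - \<mu>))) \<partial>lborel) < \<infinity>"
  shows "(\<integral>\<^sup>+x. \<integral>\<^sup>+y. ennreal (norm (x - y) powr (-\<mu>) * f y * f x) \<partial>lborel \<partial>lborel) < \<infinity>"
proof -
  define r where "r = 2 * real DIM('a) / (2 * real DIM('a) - \<mu>)"
  obtain C where C: "C > 0" and sub: "\<And>x b. b > 0 \<Longrightarrow>
    (\<integral>\<^sup>+y. ennreal (norm (x - y) powr (-\<mu>) * f y) * indicator {y. f y \<le> b} y \<partial>lborel)
      \<le> ennreal (C * b powr (r - 1))"
    using riesz_potential_sublevel_bound[OF assms(1) nonneg mu r_def] fin unfolding r_def by blast
  define T where "T x y = ennreal (norm (x - y) powr (-\<mu>) * f y * f x) * indicator {z. f z \<le> f x} y" for x y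
  \<comment> \<open>The set in the indicator moves with x, so joint measurability in x and y is
    derived from the conditional form.\<close>
  have T_alt: "T = (\<lambda>x y. ennreal (norm (x - y) powr (-\<mu>) * f y * f x) * (if f y \<le> f x then 1 else 0))"
    by (auto simp: T_def fun_eq_iff)
  have Tm [measurable]: "case_prod T \<in> borel_measurable (lborel \<Otimes>\<^sub>M lborel)"
    unfolding T_alt by measurable
  have Tm1 [measurable]: "T x \<in> borel_measurable lborel" for x
    unfolding T_alt by measurable
  have Tm2 [measurable]: "(\<lambda>y. T y x) \<in> borel_measurable lborel" for x
    unfolding T_alt by measurable
  have "(\<integral>\<^sup>+x. \<integral>\<^sup>+y. ennreal (norm (x - y) powr (-\<mu>) * f y * f x) \<partial>lborel \<partial>lborel)
    \<le> (\<integral>\<^sup>+x. \<integral>\<^sup>+y. T x y + T y x \<partial>lborel \<partial>lborel)"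
    by (intro nn_integral_mono) (auto simp: T_def norm_minus_commute mult_ac split: split_indicator)
  also have "\<dots> = (\<integral>\<^sup>+x. (\<integral>\<^sup>+y. T x y \<partial>lborel) + (\<integral>\<^sup>+y. T y x \<partial>lborel) \<partial>lborel)"
    by (simp add: nn_integral_add)
  also have "\<dots> = (\<integral>\<^sup>+x. \<integral>\<^sup>+y. T x y \<partial>lborel \<partial>lborel) + (\<integral>\<^sup>+x. \<integral>\<^sup>+y. T y x \<partial>lborel \<partial>lborel)"
    by (rule nn_integral_add) measurable
  also have "(\<integral>\<^sup>+x. \<integral>\<^sup>+y. T y x \<partial>lborel \<partial>lborel) = (\<integral>\<^sup>+x. \<integral>\<^sup>+y. T x y \<partial>lborel \<partial>lborel)"
    by (rule lborel_pair.Fubini') (rule Tm)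
  finally have le: "(\<integral>\<^sup>+x. \<integral>\<^sup>+y. ennreal (norm (x - y) powr (-\<mu>) * f y * f x) \<partial>lborel \<partial>lborel)
    \<le> (\<integral>\<^sup>+x. \<integral>\<^sup>+y. T x y \<partial>lborel \<partial>lborel) + (\<integral>\<^sup>+x. \<integral>\<^sup>+y. T x y \<partial>lborel \<partial>lborel)" .
  \<comment> \<open>The sublevel bound is taken at b = f x; the outer factor f x then raises (f
    x)^(r-1) to the integrable (f x)^r.\<close>
  have inner: "(\<integral>\<^sup>+y. T x y \<partial>lborel) \<le> ennreal C * ennreal (f x powr r)" for x
  proof (cases "f x = 0")
    case True
    then show ?thesis by (simp add: T_def)
  next
    case False
    then have fx: "f x > 0" using nonneg[of x] by simp
    have "(\<integral>\<^sup>+y. T x y \<partial>lborel)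
      = (\<integral>\<^sup>+y. ennreal (f x) * (ennreal (norm (x - y) powr (-\<mu>) * f y) * indicator {y. f y \<le> f x} y) \<partial>lborel)"
      using nonneg by (intro nn_integral_cong)
        (auto simp: T_def ennreal_mult'[symmetric] mult_ac split: split_indicator)
    also have "\<dots> = ennreal (f x) *
        (\<integral>\<^sup>+y. ennreal (norm (x - y) powr (-\<mu>) * f y) * indicator {y. f y \<le> f x} y \<partial>lborel)"
      by (rule nn_integral_cmult) measurable
    also have "\<dots> \<le> ennreal (f x) * ennreal (C * f x powr (r - 1))"
      by (intro mult_left_mono sub fx) auto
    also have "\<dots> = ennreal C * ennreal (f x powr r)"
      using fx C by (simp add: ennreal_mult'[symmetric] powr_diff)
    finally show ?thesis .
  qed
  have "(\<integral>\<^sup>+x. \<integral>\<^sup>+y. T x y \<partial>lborel \<partial>lborel) \<le> (\<integral>\<^sup>+x. ennreal C * ennreal (f x powr r) \<partial>lborel)"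
    by (rule nn_integral_mono) (rule inner)
  also have "\<dots> = ennreal C * (\<integral>\<^sup>+x. ennreal (f x powr r) \<partial>lborel)"
    by (rule nn_integral_cmult) measurable
  also have "\<dots> < \<infinity>" using fin by (simp add: r_def ennreal_mult_less_top)
  finally show ?thesis using le by (simp add: le_less_trans)
qed

section \<open>Lower bounds for the nonlocal energy\<close>

lemma hls_exp_gt_1:
  assumes "CARD('n::finite) \<ge> 3" "\<mu> < real CARD('n)"
  shows "hls_exp TYPE('n) \<mu> > 1"
  using assms by (simp add: hls_exp_def dimN_def field_simps)

text \<open>\<open>NL_energy\<close> is \<open>enn2real\<close> of this integral, which would be \<open>0\<close> if the integral were infinite;
  so bounds below in terms of \<open>NL_norm\<close> require finiteness.\<close>
definition NL_integral :: "real \<Rightarrow> (real^'n \<Rightarrow> real) \<Rightarrow> ennreal" where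
  "NL_integral \<mu> u = (\<integral>\<^sup>+ x. \<integral>\<^sup>+ y.
     ennreal (norm (x - y) powr (-\<mu>) * \<bar>u y\<bar> powr hls_exp TYPE('n) \<mu> * \<bar>u x\<bar> powr hls_exp TYPE('n) \<mu>)
       \<partial>lborel \<partial>lborel)"

lemma NL_energy_eq: "NL_energy \<mu> u = enn2real (NL_integral \<mu> u)"
  by (simp add: NL_energy_def NL_integral_def)

lemma NL_norm_nonneg: "NL_norm \<mu> u \<ge> 0"
  by (simp add: NL_norm_def)

lemma NL_norm_square: "(NL_norm \<mu> (u :: real^'n \<Rightarrow> real))\<^sup>2 = NL_energy \<mu> u powr (1 / hls_exp TYPE('n) \<mu>)"
  by (simp add: NL_norm_def power2_eq_square flip: powr_add)

text \<open>For f = |u|^p the diagonal estimate asks for the power 2n / (2n - \<mu>) of f, and p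
  times this exponent is exactly the Sobolev exponent 2n / (n - 2).\<close>

lemma NL_integral_finite:
  fixes u :: "real^'n \<Rightarrow> real"
  assumes n3: "CARD('n) \<ge> 3" and mu: "0 < \<mu>" "\<mu> < real CARD('n)"
    and [measurable]: "u \<in> borel_measurable borel"
    and fin: "(\<integral>\<^sup>+x. ennreal (\<bar>u x\<bar> powr sob_exp TYPE('n)) \<partial>lborel) < \<infinity>"
  shows "NL_integral \<mu> u < \<infinity>"
proof -
  let ?p = "hls_exp TYPE('n) \<mu>"
  have e: "?p * (2 * real CARD('n) / (2 * real CARD('n) - \<mu>)) = sob_exp TYPE('n)"
    using n3 mu by (simp add: hls_exp_def sob_exp_def dimN_def)
  show ?thesis unfolding NL_integral_def
    using mu fin e by (intro diagonal_HLS_finite) (simp_all add: powr_powr)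
qed

text \<open>A product minorant of the kernel separates the variables, so the double integral turns
  into the square of a single weighted integral, to which Hoelder's inequality can be
  applied.\<close>

lemma NL_integral_lower_bound:
  fixes w :: "real^'n \<Rightarrow> real"
  assumes mu: "0 < \<mu>" and lam: "lam > 0" and [measurable]: "w \<in> borel_measurable borel"
  shows "ennreal (lam powr \<mu>) *
     (\<integral>\<^sup>+x. ennreal (\<bar>w x\<bar> powr hls_exp TYPE('n) \<mu> * bden \<xi> lam x powr (-\<mu>/2)) \<partial>lborel)\<^sup>2
     \<le> NL_integral \<mu> w"
proof -
  define f where "f x = \<bar>w x\<bar> powr hls_exp TYPE('n) \<mu>" for x
  have [measurable]: "f \<in> borel_measurable borel" unfolding f_def by measurable
  have f0: "f x \<ge> 0" for x by (simp add: f_def)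
  define h where "h x = f x * bden \<xi> lam x powr (-\<mu>/2)" for x
  have [measurable]: "h \<in> borel_measurable borel" unfolding h_def by measurable
  have h0: "h x \<ge> 0" for x by (simp add: h_def f0)
  \<comment> \<open>On the diagonal \<open>0 powr (-\<mu>)\<close> is 0 and the bound fails; this is
    repaired below, since for each x the single point y = x is a null set.\<close>
  have kernel: "lam powr \<mu> * (bden \<xi> lam x powr (-\<mu>/2) * bden \<xi> lam y powr (-\<mu>/2)) \<le> norm (x - y) powr (-\<mu>)"
    if "x \<noteq> y" for x y
  proof -
    define a where "a = lam * norm (x - \<xi>)"
    define b where "b = lam * norm (y - \<xi>)"
    have "lam * norm (x - y) \<le> a + b"
      using lam norm_triangle_ineq4[of "x - \<xi>" "y - \<xi>"]
      by (simp add: a_def b_def flip: distrib_left)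
    then have "(lam * norm (x - y))\<^sup>2 \<le> (a + b)\<^sup>2" using lam by (intro power_mono) auto
    \<comment> \<open>The difference of the two sides is the square (1 - a b)^2.\<close>
    also have "\<dots> \<le> (1 + a\<^sup>2) * (1 + b\<^sup>2)"
      using zero_le_power2[of "1 - a * b"] by (simp add: power2_eq_square algebra_simps)
    also have "\<dots> = bden \<xi> lam x * bden \<xi> lam y" by (simp add: bden_def a_def b_def power_mult_distrib)
    finally have "(bden \<xi> lam x * bden \<xi> lam y) powr (-\<mu>/2) \<le> ((lam * norm (x - y))\<^sup>2) powr (-\<mu>/2)"
      using that lam mu by (intro powr_mono2') auto
    also have "\<dots> = lam powr (-\<mu>) * norm (x - y) powr (-\<mu>)"
      using lam by (simp add: power2_powr powr_mult)
    finally have "lam powr \<mu> * (bden \<xi> lam x * bden \<xi> lam y) powr (-\<mu>/2)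
        \<le> lam powr \<mu> * (lam powr (-\<mu>) * norm (x - y) powr (-\<mu>))"
      using lam by (intro mult_left_mono) auto
    also have "\<dots> = norm (x - y) powr (-\<mu>)"
      using lam by (simp add: powr_add[symmetric] flip: mult.assoc)
    finally show ?thesis by (simp add: powr_mult bden_pos less_imp_le)
  qed
  have pt: "ennreal (lam powr \<mu> * h x) * ennreal (h y)
     \<le> ennreal (norm (x - y) powr (-\<mu>) * f y * f x)" if "x \<noteq> y" for x y
  proof -
    have "lam powr \<mu> * h x * h y
      = (lam powr \<mu> * (bden \<xi> lam x powr (-\<mu>/2) * bden \<xi> lam y powr (-\<mu>/2))) * (f x * f y)"
      by (simp add: h_def)
    also have "\<dots> \<le> norm (x - y) powr (-\<mu>) * (f x * f y)"
      using f0 by (intro mult_right_mono kernel that) auto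
    finally show ?thesis using h0 by (simp add: ennreal_mult'[symmetric] ennreal_leI mult_ac)
  qed
  have "ennreal (lam powr \<mu>) * (\<integral>\<^sup>+x. ennreal (h x) \<partial>lborel)\<^sup>2
    = (\<integral>\<^sup>+x. ennreal (lam powr \<mu> * h x) * (\<integral>\<^sup>+y. ennreal (h y) \<partial>lborel) \<partial>lborel)"
  proof -
    have "(\<integral>\<^sup>+x. ennreal (lam powr \<mu> * h x) \<partial>lborel) = ennreal (lam powr \<mu>) * (\<integral>\<^sup>+x. ennreal (h x) \<partial>lborel)"
      by (simp add: ennreal_mult' nn_integral_cmult)
    then show ?thesis by (simp add: nn_integral_multc power2_eq_square mult.assoc)
  qed
  also have "\<dots> = (\<integral>\<^sup>+x. \<integral>\<^sup>+y. ennreal (lam powr \<mu> * h x) * ennreal (h y) \<partial>lborel \<partial>lborel)"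
    by (simp add: nn_integral_cmult)
  also have "\<dots> \<le> (\<integral>\<^sup>+x. \<integral>\<^sup>+y. ennreal (norm (x - y) powr (-\<mu>) * f y * f x) \<partial>lborel \<partial>lborel)"
  proof (rule nn_integral_mono, rule nn_integral_mono_AE)
    fix x :: "real^'n"
    show "AE y in lborel. ennreal (lam powr \<mu> * h x) * ennreal (h y)
        \<le> ennreal (norm (x - y) powr (-\<mu>) * f y * f x)"
      using AE_lborel_singleton[of x] by eventually_elim (auto intro: pt)
  qed
  finally show ?thesis by (simp add: NL_integral_def f_def h_def)
qed

text \<open>The weight is split into Q^(-\<mu>/(2p)), whose p-th power is the weight Q^(-\<mu>/2) of
  \<open>NL_integral_lower_bound\<close>, and a remainder whose q-th power is exactly Q^(-n), of
  integral at most C lam^(-n). The powers of lam add up to -\<mu>/(2p) - n/q = -(n + 2)/2, the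
  opposite of the power in the Laplacian of the bubble, so the pairing is bounded independently of
  \<open>lam\<close>.\<close>

lemma weighted_integral_le_NL_norm:
  assumes n3: "CARD('n::finite) \<ge> 3" and mu: "0 < \<mu>" "\<mu> < real CARD('n)"
  shows "\<exists>C>0. \<forall>(w :: real^'n \<Rightarrow> real) \<xi> lam. lam > 0 \<longrightarrow> w \<in> borel_measurable borel \<longrightarrow> NL_integral \<mu> w < \<infinity> \<longrightarrow>
    (\<integral>\<^sup>+x. ennreal (\<bar>w x\<bar> * bden \<xi> lam x powr (- (real CARD('n) + 2) / 2)) \<partial>lborel)
      \<le> ennreal (C * lam powr (- (real CARD('n) + 2) / 2) * NL_norm \<mu> w)"
proof -
  let ?n = "real CARD('n)"
  define p where "p = hls_exp TYPE('n) \<mu>"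
  have p1: "p > 1" using hls_exp_gt_1 n3 mu by (simp add: p_def)
  have n: "?n \<ge> 3" using n3 by simp
  have p: "p = (2 * ?n - \<mu>) / (?n - 2)" by (simp add: p_def hls_exp_def dimN_def)
  \<comment> \<open>The exponent conjugate to p, since p - 1 = (n + 2 - \<mu>) / (n - 2).\<close>
  define q where "q = (2 * ?n - \<mu>) / (?n + 2 - \<mu>)"
  have q1: "q > 1" using n mu by (simp add: q_def field_simps)
  have pq: "1 / p + 1 / q = 1" using n mu by (simp add: p q_def flip: add_divide_distrib)
  obtain C where C: "C > 0" and Qint: "\<And>(\<xi>::real^'n) lam. lam > 0 \<Longrightarrow>
    (\<integral>\<^sup>+x. ennreal (bden \<xi> lam x powr (-?n)) \<partial>lborel) \<le> ennreal (C * lam powr (- ?n))"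
    using nn_integral_bden_powr[where 'a = "real^'n" and b = ?n] n by auto
  have "(\<integral>\<^sup>+x. ennreal (\<bar>w x\<bar> * bden \<xi> lam x powr (- (?n + 2) / 2)) \<partial>lborel)
      \<le> ennreal (C powr (1/q) * lam powr (- (?n + 2) / 2) * NL_norm \<mu> w)"
    if lam: "lam > 0" and [measurable]: "w \<in> borel_measurable borel" and fin: "NL_integral \<mu> w < \<infinity>"
    for w :: "real^'n \<Rightarrow> real" and \<xi> lam
  proof -
    define f where "f x = \<bar>w x\<bar> * bden \<xi> lam x powr (-\<mu> / (2 * p))" for x
    define g where "g x = bden \<xi> lam x powr (- (?n + 2) / 2 + \<mu> / (2 * p))" for x
    have fg: "f x * g x = \<bar>w x\<bar> * bden \<xi> lam x powr (- (?n + 2) / 2)" for x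
      by (simp add: f_def g_def flip: powr_add)
    have fp: "f x powr p = \<bar>w x\<bar> powr p * bden \<xi> lam x powr (-\<mu>/2)" for x
      using p1 by (simp add: f_def powr_mult powr_powr)
    have gq: "g x powr q = bden \<xi> lam x powr (-?n)" for x
    proof -
      have "(- (?n + 2) / 2 + \<mu> / (2 * p)) * q = - ?n"
      proof -
        have "\<mu> / (2 * p) = \<mu> * (?n - 2) / (2 * (2 * ?n - \<mu>))" by (simp add: p)
        also have "- (?n + 2) / 2 + \<dots> = (\<mu> * (?n - 2) - (?n + 2) * (2 * ?n - \<mu>)) / (2 * (2 * ?n - \<mu>))"
          using mu n by (simp add: field_simps)
        also have "\<mu> * (?n - 2) - (?n + 2) * (2 * ?n - \<mu>) = - 2 * ?n * (?n + 2 - \<mu>)"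
          by (simp add: algebra_simps)
        finally have e: "- (?n + 2) / 2 + \<mu> / (2 * p) = - 2 * ?n * (?n + 2 - \<mu>) / (2 * (2 * ?n - \<mu>))" .
        define D where "D = 2 * ?n - \<mu>"
        have "D \<noteq> 0" using mu n by (simp add: D_def)
        then show ?thesis unfolding e q_def D_def[symmetric] using mu n by simp
      qed
      then show ?thesis by (simp add: g_def powr_powr)
    qed
    define I where "I = (\<integral>\<^sup>+x. ennreal (f x powr p) \<partial>lborel)"
    have E: "ennreal (lam powr \<mu>) * I\<^sup>2 \<le> NL_integral \<mu> w"
      using NL_integral_lower_bound[OF mu(1) lam, of w \<xi>] by (simp add: I_def fp flip: p_def)
    have lm: "ennreal (lam powr \<mu>) \<noteq> 0" using lam by simp
    \<comment> \<open>An infinite \<open>I\<close> would force an infinite energy, because lam^\<mu>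
      is positive; from here on the estimate lives in the reals.\<close>
    have "I \<noteq> \<infinity>"
    proof
      assume "I = \<infinity>"
      then have "ennreal (lam powr \<mu>) * I\<^sup>2 = \<infinity>" using lm by (simp add: power2_eq_square ennreal_mult_top)
      then show False using E fin by (simp add: top_unique)
    qed
    then obtain i where i: "I = ennreal i" "i \<ge> 0" by (cases I) auto
    have NE: "NL_integral \<mu> w = ennreal (NL_energy \<mu> w)" using fin by (simp add: NL_energy_eq)
    have En: "NL_energy \<mu> w \<ge> 0" by (simp add: NL_energy_def)
    have "lam powr \<mu> * i\<^sup>2 \<le> NL_energy \<mu> w"
      using E i En unfolding NE by (simp add: ennreal_power ennreal_mult'[symmetric])
    then have i2: "i\<^sup>2 \<le> lam powr (-\<mu>) * NL_energy \<mu> w"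
      using lam by (simp add: powr_minus field_simps)
    have ip: "i powr (1/p) \<le> lam powr (-\<mu> / (2 * p)) * NL_norm \<mu> w"
    proof -
      \<comment> \<open>Writing i as the square root of its square produces the exponent 1/(2p) that
        defines \<open>NL_norm\<close>.\<close>
      have "i powr (1/p) = (i\<^sup>2) powr (1 / (2*p))" using i by (simp add: power2_powr)
      also have "\<dots> \<le> (lam powr (-\<mu>) * NL_energy \<mu> w) powr (1 / (2*p))"
        using i2 p1 by (intro powr_mono2) auto
      also have "\<dots> = lam powr (-\<mu> / (2 * p)) * NL_norm \<mu> w"
        using En by (simp add: powr_mult powr_powr NL_norm_def p_def)
      finally show ?thesis .
    qed
    have "(\<integral>\<^sup>+x. ennreal (f x * g x) \<partial>lborel) \<le> ennreal (i powr (1/p) * (C * lam powr (- ?n)) powr (1/q))"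
    proof (rule nn_integral_Holder[OF _ _ _ _ p1 q1 pq])
      show "(\<integral>\<^sup>+x. ennreal (f x powr p) \<partial>lborel) \<le> ennreal i" using i by (simp add: I_def)
      show "(\<integral>\<^sup>+x. ennreal (g x powr q) \<partial>lborel) \<le> ennreal (C * lam powr (- ?n))"
        unfolding gq by (rule Qint[OF lam])
    qed (use i C in \<open>auto simp: f_def g_def\<close>)
    also have "i powr (1/p) * (C * lam powr (- ?n)) powr (1/q)
       \<le> (lam powr (-\<mu> / (2 * p)) * NL_norm \<mu> w) * (C * lam powr (- ?n)) powr (1/q)"
      using ip by (intro mult_right_mono) auto
    also have "\<dots> = C powr (1/q) * (lam powr (-\<mu> / (2 * p)) * lam powr (- ?n / q)) * NL_norm \<mu> w"
      using C by (simp add: powr_mult powr_powr mult_ac)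
    also have "lam powr (-\<mu> / (2 * p)) * lam powr (- ?n / q) = lam powr (- (?n + 2) / 2)"
    proof -
      have "-\<mu> / (2 * p) + (- ?n / q) = - (?n + 2) / 2"
      proof -
        define D where "D = 2 * ?n - \<mu>"
        have D: "D \<noteq> 0" using mu n by (simp add: D_def)
        have "-\<mu> / (2 * p) + (- ?n / q) = - \<mu> * (?n - 2) / (2 * D) + - 2 * ?n * (?n + 2 - \<mu>) / (2 * D)"
          by (simp add: p q_def D_def[symmetric])
        also have "\<dots> = (- \<mu> * (?n - 2) + - 2 * ?n * (?n + 2 - \<mu>)) / (2 * D)"
          by (simp only: add_divide_distrib)
        also have "- \<mu> * (?n - 2) + - 2 * ?n * (?n + 2 - \<mu>) = - (?n + 2) * D"
          by (simp add: D_def algebra_simps)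
        finally show ?thesis using D by simp
      qed
      then show ?thesis by (simp only: powr_add[symmetric])
    qed
    finally show ?thesis by (simp add: fg ennreal_leI)
  qed
  moreover have "C powr (1/q) > 0" using C by simp
  ultimately show ?thesis by blast
qed

lemma bubble_profile_eq_bden:
  fixes \<xi> :: "real^'n"
  assumes "lam > 0"
  shows "bubble_profile \<xi> lam x
     = lam powr ((real CARD('n) - 2) / 2) * bden \<xi> lam x powr (- (real CARD('n) - 2) / 2)"
  using assms bden_pos[of \<xi> lam x]
proof -
  have e: "- (real CARD('n) - 2) / 2 = - ((real CARD('n) - 2) / 2)"
    by (rule minus_divide_left[symmetric])
  show ?thesis
    unfolding bubble_profile_def bden_def[symmetric] dimN_def e powr_minus_divide
    using assms bden_pos[of \<xi> lam x] by (simp add: powr_divide)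
qed

text \<open>This converts the coefficient of v into its norm, hence into the norm of u. On a
  multiple of a bubble the integrand of the lower bound is |c|^p lam^(n - \<mu>/2) Q^(-n), whose
  integral is at least |c|^p k lam^(-\<mu>/2); after squaring, the prefactor lam^\<mu> removes every
  trace of the scale.\<close>

lemma NL_norm_bubble_lower_bound:
  assumes n3: "CARD('n::finite) \<ge> 3" and mu: "0 < \<mu>" "\<mu> < real CARD('n)"
  shows "\<exists>C>0. \<forall>c (\<xi> :: real^'n) lam. lam > 0 \<longrightarrow>
    NL_integral \<mu> (\<lambda>x. c * bubble_profile \<xi> lam x) < \<infinity> \<longrightarrow>
    \<bar>c\<bar> \<le> C * NL_norm \<mu> (\<lambda>x. c * bubble_profile \<xi> lam x)"
proof -
  let ?n = "real CARD('n)"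
  define p where "p = hls_exp TYPE('n) \<mu>"
  have p1: "p > 1" using hls_exp_gt_1 n3 mu by (simp add: p_def)
  have n: "?n \<ge> 3" using n3 by simp
  have p: "p = (2 * ?n - \<mu>) / (?n - 2)" by (simp add: p_def hls_exp_def dimN_def)
  \<comment> \<open>On the ball of radius 1/lam about \<open>\<xi>\<close> one has Q \<le> 2, hence
    Q^(-n) \<ge> 2^(-n); the other factor comes from the volume of that ball.\<close>
  define k where "k = 2 powr (-?n) * unit_ball_vol ?n"
  have k: "k > 0" by (simp add: k_def)
  have "k powr (1/p) * \<bar>c\<bar> \<le> NL_norm \<mu> (\<lambda>x. c * bubble_profile \<xi> lam x)"
    if lam: "lam > 0" and fin: "NL_integral \<mu> (\<lambda>x. c * bubble_profile \<xi> lam x) < \<infinity>"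
    for c lam and \<xi> :: "real^'n"
  proof -
    define w where "w x = c * bubble_profile \<xi> lam x" for x
    have [measurable]: "w \<in> borel_measurable borel"
      unfolding w_def bubble_profile_eq_bden[OF lam] by measurable
    have wp: "\<bar>w x\<bar> powr p * bden \<xi> lam x powr (-\<mu>/2) = \<bar>c\<bar> powr p * lam powr (?n - \<mu>/2) * bden \<xi> lam x powr (-?n)" for x
    proof -
      have 1: "(?n - 2) / 2 * p = ?n - \<mu>/2" using n by (simp add: p field_simps)
      have 2: "- (?n - 2) / 2 * p + (-\<mu>/2) = -?n" using n by (simp add: p field_simps)
      have "\<bar>w x\<bar> powr p * bden \<xi> lam x powr (-\<mu>/2)
        = \<bar>c\<bar> powr p * lam powr ((?n - 2) / 2 * p) * (bden \<xi> lam x powr (- (?n - 2) / 2 * p) * bden \<xi> lam x powr (-\<mu>/2))"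
        by (simp add: w_def bubble_profile_eq_bden[OF lam] abs_mult powr_mult powr_powr mult_ac)
      then show ?thesis unfolding powr_add[symmetric] 1 2 .
    qed
    have ball: "ennreal (k * lam powr (-?n)) \<le> (\<integral>\<^sup>+x. ennreal (bden \<xi> lam x powr (-?n)) \<partial>lborel)"
    proof -
      have "(1/lam)^CARD('n) = lam powr (- ?n)"
        using lam by (simp add: powr_minus_divide powr_realpow power_one_over)
      then have "ennreal (k * lam powr (-?n)) = ennreal (2 powr (-?n)) * emeasure lborel (ball \<xi> (1/lam))"
        using lam by (simp add: k_def emeasure_ball ennreal_mult'[symmetric] mult_ac)
      also have "\<dots> = (\<integral>\<^sup>+x. ennreal (2 powr (-?n)) * indicator (ball \<xi> (1/lam)) x \<partial>lborel)"
        by (simp only: nn_integral_cmult_indicator sets_lborel borel_open open_ball)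
      also have "\<dots> \<le> (\<integral>\<^sup>+x. ennreal (bden \<xi> lam x powr (-?n)) \<partial>lborel)"
      proof (rule nn_integral_mono)
        fix x
        show "ennreal (2 powr (-?n)) * indicator (ball \<xi> (1/lam)) x \<le> ennreal (bden \<xi> lam x powr (-?n))"
        proof (cases "x \<in> ball \<xi> (1/lam)")
          case True
          then have "lam * norm (x - \<xi>) < 1"
            using lam by (simp add: dist_norm norm_minus_commute field_simps)
          then have "(lam * norm (x - \<xi>))\<^sup>2 \<le> 1" using lam by (simp add: power_le_one)
          then have "bden \<xi> lam x \<le> 2" by (simp add: bden_def power_mult_distrib)
          then have "2 powr (-?n) \<le> bden \<xi> lam x powr (-?n)"
            using bden_pos by (intro powr_mono2') auto
          then show ?thesis using True by (simp add: ennreal_leI)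
        qed simp
      qed
      finally show ?thesis .
    qed
    have I: "(\<integral>\<^sup>+x. ennreal (\<bar>w x\<bar> powr p * bden \<xi> lam x powr (-\<mu>/2)) \<partial>lborel) \<ge> ennreal (\<bar>c\<bar> powr p * k * lam powr (-\<mu>/2))"
    proof -
      have "ennreal (\<bar>c\<bar> powr p * k * lam powr (-\<mu>/2)) = ennreal (\<bar>c\<bar> powr p * lam powr (?n - \<mu>/2)) * ennreal (k * lam powr (-?n))"
      proof -
        have "lam powr (?n - \<mu>/2) * lam powr (-?n) = lam powr (-\<mu>/2)" by (simp flip: powr_add)
        then have "\<bar>c\<bar> powr p * k * lam powr (-\<mu>/2) = (\<bar>c\<bar> powr p * lam powr (?n - \<mu>/2)) * (k * lam powr (-?n))"
          by (metis mult.assoc mult.left_commute)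
        then show ?thesis by (simp only: ennreal_mult'[symmetric] powr_ge_zero zero_le_mult_iff) (simp add: ennreal_mult')
      qed
      also have "\<dots> \<le> ennreal (\<bar>c\<bar> powr p * lam powr (?n - \<mu>/2)) * (\<integral>\<^sup>+x. ennreal (bden \<xi> lam x powr (-?n)) \<partial>lborel)"
        by (intro mult_left_mono ball) auto
      also have "\<dots> = (\<integral>\<^sup>+x. ennreal (\<bar>w x\<bar> powr p * bden \<xi> lam x powr (-\<mu>/2)) \<partial>lborel)"
        unfolding wp by (simp add: nn_integral_cmult ennreal_mult')
      finally show ?thesis .
    qed
    have "ennreal (lam powr \<mu>) * (ennreal (\<bar>c\<bar> powr p * k * lam powr (-\<mu>/2)))\<^sup>2
      \<le> ennreal (lam powr \<mu>) * (\<integral>\<^sup>+x. ennreal (\<bar>w x\<bar> powr p * bden \<xi> lam x powr (-\<mu>/2)) \<partial>lborel)\<^sup>2"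
      by (intro mult_left_mono power_mono I) auto
    also have "\<dots> \<le> NL_integral \<mu> w"
      unfolding p_def by (rule NL_integral_lower_bound[OF mu(1) lam]) measurable
    also have "\<dots> = ennreal (NL_energy \<mu> w)" using fin by (simp add: NL_energy_eq flip: w_def)
    finally have le: "ennreal (lam powr \<mu>) * (ennreal (\<bar>c\<bar> powr p * k * lam powr (-\<mu>/2)))\<^sup>2
      \<le> ennreal (NL_energy \<mu> w)" .
    have "ennreal (lam powr \<mu> * (\<bar>c\<bar> powr p * k * lam powr (-\<mu>/2))\<^sup>2) \<le> ennreal (NL_energy \<mu> w)"
    proof -
      have "(ennreal (\<bar>c\<bar> powr p * k * lam powr (-\<mu>/2)))\<^sup>2 = ennreal ((\<bar>c\<bar> powr p * k * lam powr (-\<mu>/2))\<^sup>2)"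
        using k by (intro ennreal_power) simp
      then show ?thesis using le by (simp only: ennreal_mult'[OF powr_ge_zero])
    qed
    then have "lam powr \<mu> * (\<bar>c\<bar> powr p * k * lam powr (-\<mu>/2))\<^sup>2 \<le> NL_energy \<mu> w"
      by (simp add: NL_energy_def)
    also have "lam powr \<mu> * (\<bar>c\<bar> powr p * k * lam powr (-\<mu>/2))\<^sup>2 = (\<bar>c\<bar> powr p * k)\<^sup>2"
    proof -
      have "(lam powr (-\<mu>/2))\<^sup>2 = lam powr (-\<mu>)"
        by (simp add: power2_eq_square flip: powr_add)
      then show ?thesis using lam by (simp add: power_mult_distrib powr_minus)
    qed
    finally have "((\<bar>c\<bar> powr p * k)\<^sup>2) powr (1 / (2 * p)) \<le> NL_energy \<mu> w powr (1 / (2 * p))"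
      using p1 by (intro powr_mono2) auto
    moreover have "((\<bar>c\<bar> powr p * k)\<^sup>2) powr (1 / (2 * p)) = k powr (1/p) * \<bar>c\<bar>"
      using k p1 by (simp add: power2_powr powr_mult powr_powr)
    ultimately show ?thesis by (simp add: NL_norm_def flip: p_def w_def)
  qed
  then have "\<bar>c\<bar> \<le> 1 / k powr (1/p) * NL_norm \<mu> (\<lambda>x. c * bubble_profile \<xi> lam x)"
    if "lam > 0" "NL_integral \<mu> (\<lambda>x. c * bubble_profile \<xi> lam x) < \<infinity>"
    for c lam and \<xi> :: "real^'n"
    using that k by (simp add: field_simps)
  moreover have "1 / k powr (1/p) > 0" using k by simp
  ultimately show ?thesis by blast
qed

section \<open>Calculus of C^k functions\<close>

lemma grad_nth_eq:
  assumes "(f has_derivative D) (at x)"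
  shows "grad f x $ i = D (axis i 1)"
  using frechet_derivative_at[OF assms] by (simp add: grad_def)

lemma grad_eq:
  assumes "(f has_derivative (\<lambda>h. g \<bullet> h)) (at x)"
  shows "grad f x = g"
  by (simp add: vec_eq_iff grad_nth_eq[OF assms] inner_axis)

lemma grad_has_derivative:
  fixes f :: "real^'n \<Rightarrow> real"
  assumes "f differentiable (at x)"
  shows "(f has_derivative (\<lambda>h. grad f x \<bullet> h)) (at x)"
proof -
  let ?D = "frechet_derivative f (at x)"
  have D: "(f has_derivative ?D) (at x)" using assms by (simp add: frechet_derivative_works)
  interpret bounded_linear ?D using D by (rule has_derivative_bounded_linear)
  have "?D h = grad f x \<bullet> h" for h
  proof -
    have "?D h = ?D (\<Sum>i\<in>UNIV. (h $ i) *\<^sub>R axis i 1)"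
      using basis_expansion[of h] by (simp add: scalar_mult_eq_scaleR)
    also have "\<dots> = (\<Sum>i\<in>UNIV. (h $ i) * ?D (axis i 1))" by (simp add: sum scaleR)
    finally show ?thesis by (simp add: inner_vec_def grad_def mult.commute)
  qed
  then show ?thesis using D by (metis (no_types, lifting) ext)
qed

lemma Ck_imp_continuous: "Ck k f \<Longrightarrow> continuous_on UNIV f"
  by (cases k) (simp, metis Ck.simps(2) continuous_at_imp_continuous_on differentiable_imp_continuous_within)

text \<open>\<open>Ck (Suc k)\<close> speaks of differentiability and of the partial derivatives,
  never of the lower levels, so monotonicity needs an induction; its base is that differentiable
  functions are continuous.\<close>

lemma Ck_Suc_imp: "Ck (Suc k) f \<Longrightarrow> Ck k f"
proof (induction k arbitrary: f)
  case 0
  then show ?case by (simp only: Ck.simps(1)) (rule Ck_imp_continuous[OF 0])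
next
  case (Suc k)
  then show ?case by (simp del: Ck.simps(2) add: Ck.simps(2)[of "Suc k"] Ck.simps(2)[of k f])
qed

lemma Ck_const: "Ck k (\<lambda>x::real^'n. c)"
proof (induction k arbitrary: c)
  case (Suc k)
  have "grad (\<lambda>x. c) x $ i = 0" for x :: "real^'n" and i by (subst grad_nth_eq[OF has_derivative_const]) simp
  then show ?case using Suc by simp
qed simp

lemma Ck_coordinate: "Ck k (\<lambda>x::real^'n. x $ i)"
proof (cases k)
  case (Suc k)
  have d: "((\<lambda>x. x $ i) has_derivative (\<lambda>h. h $ i)) (at x)" for x :: "real^'n"
    by (rule bounded_linear_imp_has_derivative) (rule bounded_linear_vec_nth)
  have "grad (\<lambda>x. x $ i) x $ j = axis j 1 $ i" for x :: "real^'n" and j by (rule grad_nth_eq[OF d])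
  then show ?thesis using Suc d Ck_const by (auto simp: differentiable_def)
qed (auto intro!: continuous_intros)

lemma Ck_add: "Ck k f \<Longrightarrow> Ck k g \<Longrightarrow> Ck k (\<lambda>x. f x + g x)"
proof (induction k arbitrary: f g)
  case (Suc k)
  have "grad (\<lambda>x. f x + g x) x $ i = grad f x $ i + grad g x $ i" for x i
    using Suc.prems by (subst grad_nth_eq[OF has_derivative_add[OF grad_has_derivative grad_has_derivative]])
      (auto simp: inner_axis)
  then show ?case using Suc by auto
qed (auto intro: continuous_on_add)

lemma Ck_mult: "Ck k f \<Longrightarrow> Ck k g \<Longrightarrow> Ck k (\<lambda>x. f x * g x)"
proof (induction k arbitrary: f g)
  case (Suc k)
  have "grad (\<lambda>x. f x * g x) x $ i = f x * grad g x $ i + grad f x $ i * g x" for x i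
    using Suc.prems by (subst grad_nth_eq[OF has_derivative_mult[OF grad_has_derivative grad_has_derivative]])
      (auto simp: inner_axis)
  then show ?case using Suc Ck_Suc_imp[OF Suc.prems(1)] Ck_Suc_imp[OF Suc.prems(2)]
    by (auto intro!: Ck_add)
qed (auto intro: continuous_on_mult)

lemma Ck_sum: "(\<And>i. i \<in> I \<Longrightarrow> Ck k (f i)) \<Longrightarrow> Ck k (\<lambda>x. \<Sum>i\<in>I. f i x)"
  by (induction I rule: infinite_finite_induct) (auto intro: Ck_const Ck_add)

text \<open>\<open>D\<close> is the sequence of all derivatives of the outer function.\<close>
lemma Ck_compose:
  fixes D :: "nat \<Rightarrow> real \<Rightarrow> real"
  assumes D: "\<And>m s. s \<in> S \<Longrightarrow> (D m has_real_derivative D (Suc m) s) (at s)"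
    and S: "\<And>x. f x \<in> S" and "Ck k f"
  shows "Ck k (\<lambda>x. D m (f x))"
  using assms(3)
proof (induction k arbitrary: m)
  case 0
  have "continuous_on S (D m)"
    by (rule continuous_at_imp_continuous_on) (use D DERIV_isCont in blast)
  then show ?case using 0 S by (auto intro: continuous_on_compose2)
next
  case (Suc k)
  have d: "((\<lambda>x. D m (f x)) has_derivative (\<lambda>h. D (Suc m) (f x) * (grad f x \<bullet> h))) (at x)" for x
  proof -
    have 1: "(f has_derivative (\<lambda>h. grad f x \<bullet> h)) (at x)"
      using Suc.prems by (auto intro: grad_has_derivative)
    have 2: "(D m has_derivative (*) (D (Suc m) (f x))) (at (f x))"
      using D[OF S] by (simp add: has_field_derivative_def)
    show ?thesis by (rule has_derivative_compose[OF 1 2])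
  qed
  have "grad (\<lambda>x. D m (f x)) x $ i = D (Suc m) (f x) * grad f x $ i" for x i
    by (simp add: grad_nth_eq[OF d] inner_axis)
  then show ?case
    using d Suc.prems Suc.IH[OF Ck_Suc_imp[OF Suc.prems]] by (auto simp: differentiable_def intro: Ck_mult)
qed

lemma Ck_powr:
  assumes "\<And>x. f x > 0" "Ck k f"
  shows "Ck k (\<lambda>x. f x powr a)"
proof -
  \<comment> \<open>A falling factorial times a power: the m-th derivative of
    \<open>s powr a\<close> on the half-line s > 0.\<close>
  define D where "D m s = (\<Prod>i<m. a - real i) * s powr (a - real m)" for m and s :: real
  have "Ck k (\<lambda>x. D 0 (f x))"
  proof (rule Ck_compose[where D = D and S = "{0<..}"])
    fix m and s :: real assume "s \<in> {0<..}"
    then have "(D m has_real_derivative (\<Prod>i<m. a - real i) * ((a - real m) * s powr (a - real m - 1))) (at s)"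
      unfolding D_def by (intro DERIV_cmult has_real_derivative_powr) auto
    moreover have "a - real m - 1 = a - real (Suc m)" by simp
    ultimately show "(D m has_real_derivative D (Suc m) s) (at s)"
      by (simp only: D_def prod.lessThan_Suc mult.assoc)
  qed (use assms in auto)
  then show ?thesis by (simp add: D_def)
qed

section \<open>A smooth cutoff that is flat at the origin\<close>

definition flat_cutoff :: "real \<Rightarrow> real" where
  "flat_cutoff y = (if y > 0 then exp (- (1 / y)) else 0)"

text \<open>A class containing \<open>flat_cutoff\<close> and closed under differentiation, so that
  all derivatives of the cutoff are described by polynomials in 1/y.\<close>

definition flat_poly :: "real poly \<Rightarrow> real \<Rightarrow> real" where
  "flat_poly P y = (if y > 0 then poly P (1 / y) * exp (- (1 / y)) else 0)"

lemma poly_exp_minus_tendsto_0: "((\<lambda>x::real. poly P x * exp (- x)) \<longlongrightarrow> 0) at_top"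
proof -
  have "((\<lambda>x::real. \<Sum>i\<le>degree P. coeff P i * (x ^ i / exp x)) \<longlongrightarrow> (\<Sum>i\<le>degree P. coeff P i * 0)) at_top"
    by (intro tendsto_intros tendsto_power_div_exp_0)
  then show ?thesis by (simp add: poly_altdef sum_distrib_right exp_minus divide_inverse mult.assoc)
qed

text \<open>With z = 1/y the derivative in y is -z^2 times that in z, which sends P(z) e^(-z) to z^2
  (P - P')(z) e^(-z). At y = 0 the right-hand difference quotient is z P(z) e^(-z) with z tending to
  infinity, where the exponential wins.\<close>

lemma flat_poly_has_derivative:
  "(flat_poly P has_real_derivative flat_poly (monom 1 2 * (P - pderiv P)) y) (at y)"
proof (cases y "0::real" rule: linorder_cases)
  case less
  have "((\<lambda>_. 0) has_real_derivative 0) (at y)" by simp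
  then have "(flat_poly P has_real_derivative 0) (at y)"
    by (rule has_field_derivative_transform_within_open[of _ _ _ "{..<0}"]) (use less in \<open>auto simp: flat_poly_def\<close>)
  then show ?thesis using less by (simp add: flat_poly_def)
next
  case equal
  have "((\<lambda>h. flat_poly P h / h) \<longlongrightarrow> 0) (at 0)"
  proof (rule filterlim_split_at)
    show "((\<lambda>h. flat_poly P h / h) \<longlongrightarrow> 0) (at_left 0)"
      by (rule tendsto_eventually) (auto simp: flat_poly_def eventually_at_filter)
    have "((\<lambda>h. poly (monom 1 1 * P) (inverse h) * exp (- inverse h)) \<longlongrightarrow> 0) (at_right 0)"
      by (rule filterlim_compose[OF poly_exp_minus_tendsto_0 filterlim_inverse_at_top_right])
    then show "((\<lambda>h. flat_poly P h / h) \<longlongrightarrow> 0) (at_right 0)"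
      by (rule Lim_transform_eventually)
        (auto simp: flat_poly_def eventually_at_filter poly_monom field_simps)
  qed
  then show ?thesis using equal by (simp add: has_field_derivative_iff flat_poly_def)
next
  case greater
  have "((\<lambda>y. poly P (1 / y) * exp (- (1 / y))) has_real_derivative
     poly (monom 1 2 * (P - pderiv P)) (1 / y) * exp (- (1 / y))) (at y)"
    using greater by (auto intro!: derivative_eq_intros DERIV_chain2[OF poly_DERIV]
      simp: poly_monom field_simps power2_eq_square)
  then have "(flat_poly P has_real_derivative poly (monom 1 2 * (P - pderiv P)) (1 / y) * exp (- (1 / y))) (at y)"
    by (rule has_field_derivative_transform_within_open[of _ _ _ "{0<..}"]) (use greater in \<open>auto simp: flat_poly_def\<close>)
  then show ?thesis using greater by (simp add: flat_poly_def)
qed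

lemma flat_cutoff_eq: "flat_cutoff = flat_poly 1"
  by (auto simp: fun_eq_iff flat_poly_def flat_cutoff_def)

text \<open>At y = 0 the formula reads \<open>0 / 0\<close>, whose default value 0 is the true
  derivative there.\<close>

lemma flat_cutoff_has_derivative: "(flat_cutoff has_real_derivative flat_cutoff y / y\<^sup>2) (at y)"
proof -
  have "flat_poly (monom 1 2 * (1 - pderiv 1)) y = flat_cutoff y / y\<^sup>2"
    by (simp add: flat_poly_def flat_cutoff_def poly_monom power_one_over divide_inverse power_inverse)
  then show ?thesis using flat_poly_has_derivative[of 1 y] by (simp add: flat_cutoff_eq)
qed

lemma Ck_flat_cutoff:
  assumes "Ck k f"
  shows "Ck k (\<lambda>x. flat_cutoff (f x))"
proof -
  define D where "D m = flat_poly (((\<lambda>P. monom 1 2 * (P - pderiv P)) ^^ m) 1)" for m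
  have "Ck k (\<lambda>x. D 0 (f x))"
    by (rule Ck_compose[where D = D and S = UNIV]) (use assms in \<open>auto simp: D_def intro: flat_poly_has_derivative\<close>)
  then show ?thesis by (simp add: D_def flat_cutoff_eq)
qed

section \<open>Green's identity\<close>

lemma continuous_on_grad:
  assumes "Ck (Suc k) f"
  shows "continuous_on UNIV (grad f)"
proof -
  have "continuous_on UNIV (\<lambda>x. grad f x $ i)" for i
    using assms Ck_imp_continuous by auto
  then have "continuous_on UNIV (\<lambda>x. \<chi> i. grad f x $ i)"
    by (intro continuous_on_vec_lambda)
  then show ?thesis by simp
qed

lemma integrable_continuous_bounded_support:
  fixes f :: "'a::euclidean_space \<Rightarrow> real"
  assumes "continuous_on UNIV f" "bounded {x. f x \<noteq> 0}"
  shows "integrable lborel f"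
proof -
  let ?S = "closure {x. f x \<noteq> 0}"
  have "integrable lborel (\<lambda>x. indicator ?S x *\<^sub>R f x)"
    using assms by (intro borel_integrable_compact) (auto intro: continuous_on_subset)
  moreover have "(\<lambda>x. indicator ?S x *\<^sub>R f x) = f"
    using closure_subset[of "{x. f x \<noteq> 0}"] by (force simp: fun_eq_iff split: split_indicator)
  ultimately show ?thesis by (simp only:)
qed

lemma grad_eq_0_outside:
  assumes "open T" "x \<in> T" "\<And>y. y \<in> T \<Longrightarrow> f y = 0"
  shows "grad f x = 0"
proof -
  have "((\<lambda>_. 0) has_derivative (\<lambda>h. 0 \<bullet> h)) (at x)" by simp
  then have "(f has_derivative (\<lambda>h. 0 \<bullet> h)) (at x)"
    by (rule has_derivative_transform_within_open[OF _ assms(1,2)]) (simp add: assms(3))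
  then show ?thesis by (rule grad_eq)
qed

text \<open>The difference quotients of F in direction i have integral 0, because Lebesgue measure
  is invariant under translation; they converge to the partial derivative, and the mean value
  theorem supplies the domination. No iterated integration over lines is involved.\<close>

lemma integral_partial_derivative_eq_0:
  fixes F :: "real^'n \<Rightarrow> real"
  assumes d: "\<And>x. F differentiable (at x)" and cont: "continuous_on UNIV (\<lambda>x. grad F x $ i)"
    and bd: "bounded {x. F x \<noteq> 0}"
  shows "integrable lborel (\<lambda>x. grad F x $ i)" "(\<integral>x. grad F x $ i \<partial>lborel) = 0"
proof -
  let ?g = "\<lambda>x. grad F x $ i"
  obtain R where R: "\<And>x. F x \<noteq> 0 \<Longrightarrow> norm x \<le> R" using bd by (auto simp: bounded_iff)
  have g0: "?g x = 0" if "norm x > R" for x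
    using grad_eq_0_outside[of "- cball 0 R" x F] R that by (fastforce simp: dist_norm)
  then have "{x. ?g x \<noteq> 0} \<subseteq> cball 0 R" by (force simp: dist_norm)
  then have gbd: "bounded {x. ?g x \<noteq> 0}" using bounded_subset bounded_cball by blast
  show gint: "integrable lborel ?g" by (rule integrable_continuous_bounded_support[OF cont gbd])
  have "compact (?g ` cball 0 R)"
    by (intro compact_continuous_image continuous_on_subset[OF cont]) auto
  then obtain M where M: "\<And>x. norm x \<le> R \<Longrightarrow> \<bar>?g x\<bar> \<le> M"
    by (fastforce simp: bounded_iff dest: compact_imp_bounded)
  \<comment> \<open>\<open>M\<close> bounds the derivative on the ball only and might be negative if
    R < 0 makes the ball empty; the maximum with 0 also covers the outside, where the derivative
    vanishes.\<close>
  have M': "\<bar>?g x\<bar> \<le> max M 0" for x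
    using M[of x] g0[of x] by (cases "norm x \<le> R") auto
  define e :: "real^'n" where "e = axis i 1"
  have ne: "norm e = 1" by (simp add: e_def norm_axis_1)
  have line: "((\<lambda>t. F (x + t *\<^sub>R e)) has_real_derivative ?g (x + t *\<^sub>R e)) (at t)" for x t
  proof -
    have "((\<lambda>t. F (x + t *\<^sub>R e)) has_derivative (\<lambda>h. grad F (x + t *\<^sub>R e) \<bullet> (h *\<^sub>R e))) (at t)"
      by (rule has_derivative_compose[where g = F, OF _ grad_has_derivative[OF d]])
        (auto intro!: derivative_eq_intros)
    then show ?thesis by (simp add: has_field_derivative_def e_def inner_axis mult_commute_abs)
  qed
  define s where "s k x = real (Suc k) * (F (x + (1 / real (Suc k)) *\<^sub>R e) - F x)" for k x
  have s_mvt: "\<exists>\<theta>. 0 < \<theta> \<and> \<theta> < 1 \<and> s k x = ?g (x + \<theta> *\<^sub>R e)" for k x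
  proof -
    have "\<exists>z::real. z > 0 \<and> z < 1 / real (Suc k) \<and>
      F (x + (1 / real (Suc k)) *\<^sub>R e) - F (x + 0 *\<^sub>R e) = (1 / real (Suc k) - 0) * ?g (x + z *\<^sub>R e)"
      by (rule MVT2[where f = "\<lambda>t. F (x + t *\<^sub>R e)"]) (auto intro: line)
    then obtain z where z: "z > 0" "z < 1 / real (Suc k)"
      "F (x + (1 / real (Suc k)) *\<^sub>R e) - F x = 1 / real (Suc k) * ?g (x + z *\<^sub>R e)" by auto
    have "z < 1" using z(2) by (rule less_le_trans) simp
    moreover have "s k x = ?g (x + z *\<^sub>R e)" unfolding s_def z(3) by simp
    ultimately show ?thesis using z(1) by blast
  qed
  have Fcont: "continuous_on UNIV F"
    using d by (intro continuous_at_imp_continuous_on) (auto intro: differentiable_imp_continuous_within)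
  have Fint: "integrable lborel F" by (rule integrable_continuous_bounded_support[OF Fcont bd])
  have [measurable]: "F \<in> borel_measurable borel" "?g \<in> borel_measurable borel"
    using Fcont cont by (auto intro: borel_measurable_continuous_onI)
  have shift: "integrable lborel (\<lambda>x. F (x + a))" "(\<integral>x. F (x + a) \<partial>lborel) = (\<integral>x. F x \<partial>lborel)" for a
  proof -
    have *: "lborel = distr lborel borel ((+) a)" by (rule lborel_distr_plus[symmetric])
    show "integrable lborel (\<lambda>x. F (x + a))"
      using Fint by (subst (asm) *) (simp add: integrable_distr_eq add.commute)
    show "(\<integral>x. F (x + a) \<partial>lborel) = (\<integral>x. F x \<partial>lborel)"
      by (subst (2) *) (simp add: integral_distr add.commute)
  qed
  have s0: "(\<integral>x. s k x \<partial>lborel) = 0" for k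
    unfolding s_def using shift Fint by simp
  \<comment> \<open>The intermediate point of the mean value theorem is less than 1 away from x, so
    every quotient vanishes outside radius R + 1.\<close>
  have "(\<lambda>k. \<integral>x. s k x \<partial>lborel) \<longlonglongrightarrow> (\<integral>x. ?g x \<partial>lborel)"
  proof (rule integral_dominated_convergence[where w = "\<lambda>x. max M 0 * indicator (cball 0 (R + 1)) x"])
    show "integrable lborel (\<lambda>x::real^'n. max M 0 * indicator (cball 0 (R + 1)) x)"
      using emeasure_lborel_cball_finite[of "0 :: real^'n" "R + 1"]
      by (intro integrable_mult_right integrable_real_indicator) (auto simp: less_top)
    show "AE x in lborel. (\<lambda>k. s k x) \<longlonglongrightarrow> ?g x"
    proof (rule AE_I2)
      fix x
      have "((\<lambda>h. (F (x + (0 + h) *\<^sub>R e) - F (x + 0 *\<^sub>R e)) / h) \<longlongrightarrow> ?g (x + 0 *\<^sub>R e)) (at 0)"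
        using line[of x 0] unfolding has_field_derivative_iff by simp
      then have "(\<lambda>k. (F (x + (0 + 1 / real (Suc k)) *\<^sub>R e) - F (x + 0 *\<^sub>R e)) / (1 / real (Suc k))) \<longlonglongrightarrow> ?g (x + 0 *\<^sub>R e)"
      proof (rule filterlim_compose)
        have "(\<lambda>k. 1 / real (Suc k)) \<longlonglongrightarrow> 0"
          using LIMSEQ_inverse_real_of_nat by (simp add: inverse_eq_divide)
        then show "filterlim (\<lambda>k. 1 / real (Suc k)) (at 0) sequentially"
          by (auto simp: filterlim_at)
      qed
      then show "(\<lambda>k. s k x) \<longlonglongrightarrow> ?g x" by (simp add: s_def mult.commute)
    qed
    show "AE x in lborel. norm (s k x) \<le> max M 0 * indicator (cball 0 (R + 1)) x" for k
    proof (rule AE_I2)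
      fix x
      obtain \<theta> where th: "0 < \<theta>" "\<theta> < 1" "s k x = ?g (x + \<theta> *\<^sub>R e)" using s_mvt by blast
      show "norm (s k x) \<le> max M 0 * indicator (cball 0 (R + 1)) x"
      proof (cases "norm x \<le> R + 1")
        case True
        then show ?thesis using M'[of "x + \<theta> *\<^sub>R e"] th by (simp add: dist_norm)
      next
        case False
        have "norm x \<le> norm (x + \<theta> *\<^sub>R e) + norm (\<theta> *\<^sub>R e)"
          using norm_triangle_ineq4[of "x + \<theta> *\<^sub>R e" "\<theta> *\<^sub>R e"] by simp
        then have "norm (x + \<theta> *\<^sub>R e) > R" using False th ne by simp
        then show ?thesis using g0 th False by simp
      qed
    qed
  qed (auto simp: s_def)
  then show "(\<integral>x. ?g x \<partial>lborel) = 0" by (simp add: s0 LIMSEQ_const_iff)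
qed

text \<open>The fields \<phi> times the i-th partial derivative of U have bounded support, so their
  i-th partial derivatives integrate to 0; the sum of these over i is the divergence, by the product
  rule the sum of both integrands. Decay of U is not an issue since \<phi> carries the
  support.\<close>

lemma Green_smooth_cs:
  fixes U :: "real^'n \<Rightarrow> real"
  assumes phi: "smooth_cs \<phi>" and U: "Ck 2 U"
  shows "integrable lborel (\<lambda>x. grad \<phi> x \<bullet> grad U x)" "integrable lborel (\<lambda>x. \<phi> x * laplacian U x)"
    "(\<integral>x. grad \<phi> x \<bullet> grad U x \<partial>lborel) = - (\<integral>x. \<phi> x * laplacian U x \<partial>lborel)"
proof -
  have phik: "Ck k \<phi>" for k using phi by (simp add: smooth_cs_def)
  have bd: "bounded {x. \<phi> x \<noteq> 0}" using phi by (simp add: smooth_cs_def)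
  have Ui: "Ck 1 (\<lambda>y. grad U y $ i)" for i using U by (simp add: numeral_2_eq_2)
  have Uii: "continuous_on UNIV (\<lambda>x. grad (\<lambda>y. grad U y $ i) x $ j)" for i j using Ui[of i] by simp
  have lap: "laplacian U x = (\<Sum>i\<in>UNIV. grad (\<lambda>y. grad U y $ i) x $ i)" for x
    by (simp add: laplacian_def grad_def)
  have phic: "continuous_on UNIV \<phi>" using phik[of 0] by simp
  have gphic: "continuous_on UNIV (grad \<phi>)" by (rule continuous_on_grad[OF phik[of "Suc 0"]])
  have gUc: "continuous_on UNIV (grad U)"
    using U by (intro continuous_on_grad[of 1]) (simp add: numeral_2_eq_2)
  have lapc: "continuous_on UNIV (laplacian U)"
    unfolding lap[abs_def] by (intro continuous_on_sum Uii)
  obtain R where R: "\<And>x. \<phi> x \<noteq> 0 \<Longrightarrow> norm x \<le> R" using bd by (auto simp: bounded_iff)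
  have g0: "grad \<phi> x = 0" if "norm x > R" for x
    using grad_eq_0_outside[of "- cball 0 R" x \<phi>] R that by (fastforce simp: dist_norm)
  have bdd: "bounded {x. f x \<noteq> 0}" if "\<And>x. norm x > R \<Longrightarrow> f x = 0" for f :: "real^'n \<Rightarrow> real"
  proof -
    have "{x. f x \<noteq> 0} \<subseteq> cball 0 R" using that by (force simp: dist_norm)
    then show ?thesis using bounded_subset bounded_cball by blast
  qed
  have phi0: "\<phi> x = 0" if "norm x > R" for x using R[of x] that by force
  show 1: "integrable lborel (\<lambda>x. grad \<phi> x \<bullet> grad U x)"
    by (intro integrable_continuous_bounded_support continuous_on_inner gphic gUc bdd) (simp add: g0)
  show 2: "integrable lborel (\<lambda>x. \<phi> x * laplacian U x)"
    by (intro integrable_continuous_bounded_support continuous_on_mult phic lapc bdd) (simp add: phi0)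
  define F where "F i x = \<phi> x * grad U x $ i" for i x
  have F1: "Ck 1 (F i)" for i unfolding F_def by (intro Ck_mult phik Ui)
  have gF: "grad (F i) x $ i = \<phi> x * grad (\<lambda>y. grad U y $ i) x $ i + grad \<phi> x $ i * grad U x $ i" for i x
  proof -
    have 1: "(\<phi> has_derivative (\<lambda>h. grad \<phi> x \<bullet> h)) (at x)"
      by (rule grad_has_derivative) (use phik[of "Suc 0"] in simp)
    have 2: "((\<lambda>y. grad U y $ i) has_derivative (\<lambda>h. grad (\<lambda>y. grad U y $ i) x \<bullet> h)) (at x)"
      by (rule grad_has_derivative) (use Ui[of i] in simp)
    show ?thesis
      unfolding F_def by (simp add: grad_nth_eq[OF has_derivative_mult[OF 1 2]] inner_axis)
  qed
  have Fbd: "bounded {x. F i x \<noteq> 0}" for i by (rule bdd) (simp add: F_def phi0)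
  have Fi: "integrable lborel (\<lambda>x. grad (F i) x $ i)" "(\<integral>x. grad (F i) x $ i \<partial>lborel) = 0" for i
    using F1[of i] Fbd[of i] by (auto intro!: integral_partial_derivative_eq_0)
  have "(\<integral>x. (\<Sum>i\<in>UNIV. grad (F i) x $ i) \<partial>lborel) = 0"
    using Fi by (subst Bochner_Integration.integral_sum) auto
  moreover have "(\<Sum>i\<in>UNIV. grad (F i) x $ i) = grad \<phi> x \<bullet> grad U x + \<phi> x * laplacian U x" for x
    by (simp add: gF lap inner_vec_def sum.distrib sum_distrib_left)
  ultimately show "(\<integral>x. grad \<phi> x \<bullet> grad U x \<partial>lborel) = - (\<integral>x. \<phi> x * laplacian U x \<partial>lborel)"
    using 1 2 by simp
qed

section \<open>Finiteness and limits along approximating sequences\<close>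

lemma ennreal_powr_add_le:
  fixes a b :: real
  assumes "p > 0"
  shows "ennreal (\<bar>a + b\<bar> powr p) \<le> ennreal (2 powr p) * (ennreal (\<bar>a\<bar> powr p) + ennreal (\<bar>b\<bar> powr p))"
proof -
  have "\<bar>a + b\<bar> powr p \<le> (2 * max \<bar>a\<bar> \<bar>b\<bar>) powr p" using assms by (intro powr_mono2) auto
  also have "\<dots> = 2 powr p * (max \<bar>a\<bar> \<bar>b\<bar>) powr p" by (simp add: powr_mult)
  also have "\<dots> \<le> 2 powr p * (\<bar>a\<bar> powr p + \<bar>b\<bar> powr p)"
    by (intro mult_left_mono) (auto simp: max_def)
  finally show ?thesis
    by (simp add: ennreal_leI flip: ennreal_mult' ennreal_plus)
qed

lemma nn_integral_powr_add_finite: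
  fixes f g :: "'a \<Rightarrow> real"
  assumes [measurable]: "f \<in> borel_measurable M" "g \<in> borel_measurable M" and "p > 0"
    and "(\<integral>\<^sup>+x. ennreal (\<bar>f x\<bar> powr p) \<partial>M) < \<infinity>" "(\<integral>\<^sup>+x. ennreal (\<bar>g x\<bar> powr p) \<partial>M) < \<infinity>"
  shows "(\<integral>\<^sup>+x. ennreal (\<bar>f x + g x\<bar> powr p) \<partial>M) < \<infinity>"
proof -
  have "(\<integral>\<^sup>+x. ennreal (\<bar>f x + g x\<bar> powr p) \<partial>M)
    \<le> (\<integral>\<^sup>+x. ennreal (2 powr p) * (ennreal (\<bar>f x\<bar> powr p) + ennreal (\<bar>g x\<bar> powr p)) \<partial>M)"
    by (intro nn_integral_mono ennreal_powr_add_le assms)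
  also have "\<dots> = ennreal (2 powr p) *
      ((\<integral>\<^sup>+x. ennreal (\<bar>f x\<bar> powr p) \<partial>M) + (\<integral>\<^sup>+x. ennreal (\<bar>g x\<bar> powr p) \<partial>M))"
    by (simp add: nn_integral_cmult nn_integral_add)
  also have "\<dots> < \<infinity>" using assms(4,5) by (simp add: ennreal_mult_less_top)
  finally show ?thesis .
qed

lemma nn_integral_powr_finite_smooth_cs:
  fixes \<phi> :: "real^'n \<Rightarrow> real"
  assumes "continuous_on UNIV \<phi>" "bounded {x. \<phi> x \<noteq> 0}" "p > 0"
  shows "(\<integral>\<^sup>+x. ennreal (\<bar>\<phi> x\<bar> powr p) \<partial>lborel) < \<infinity>"
proof -
  have "integrable lborel (\<lambda>x. \<bar>\<phi> x\<bar> powr p)"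
    using assms by (intro integrable_continuous_bounded_support continuous_on_powr' continuous_intros) auto
  then show ?thesis by (simp add: integrable_iff_bounded)
qed

text \<open>A single approximant at distance less than 1 suffices: it is smooth with bounded
  support, so its powers and those of its gradient are integrable, and the limit differs from it by
  an integrable error.\<close>

lemma D12_nn_integral_finite:
  fixes u :: "real^'n \<Rightarrow> real"
  assumes D: "D12 u G" and n3: "CARD('n) \<ge> 3"
  shows "(\<integral>\<^sup>+x. ennreal (\<bar>u x\<bar> powr sob_exp TYPE('n)) \<partial>lborel) < \<infinity>"
    "(\<integral>\<^sup>+x. ennreal ((norm (G x))\<^sup>2) \<partial>lborel) < \<infinity>"
proof -
  let ?s = "sob_exp TYPE('n)"
  have s: "?s > 0" using n3 by (simp add: sob_exp_def dimN_def)
  obtain \<phi> where phi: "\<And>k. smooth_cs (\<phi> k)"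
    and lim1: "(\<lambda>k. \<integral>\<^sup>+ x. ennreal ((norm (grad (\<phi> k) x - G x))\<^sup>2) \<partial>lborel) \<longlonglongrightarrow> 0"
    and lim2: "(\<lambda>k. \<integral>\<^sup>+ x. ennreal (\<bar>\<phi> k x - u x\<bar> powr ?s) \<partial>lborel) \<longlonglongrightarrow> 0"
    and [measurable]: "u \<in> borel_measurable borel" "G \<in> borel_measurable borel"
    using D by (auto simp: D12_def)
  have Ck: "Ck k (\<phi> m)" and bd: "bounded {x. \<phi> m x \<noteq> 0}" for k m using phi by (auto simp: smooth_cs_def)
  have c1: "continuous_on UNIV (\<phi> k)" and c2: "continuous_on UNIV (grad (\<phi> k))" for k
    using Ck[of 0 k] continuous_on_grad[OF Ck[of "Suc 0" k]] by auto
  have [measurable]: "\<phi> k \<in> borel_measurable borel" "grad (\<phi> k) \<in> borel_measurable borel" for k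
    using c1 c2 by (auto intro: borel_measurable_continuous_onI)
  have "\<forall>\<^sub>F k in sequentially. (\<integral>\<^sup>+ x. ennreal (\<bar>\<phi> k x - u x\<bar> powr ?s) \<partial>lborel) < 1"
    using lim2 by (rule order_tendstoD) simp
  then obtain k where k: "(\<integral>\<^sup>+ x. ennreal (\<bar>\<phi> k x - u x\<bar> powr ?s) \<partial>lborel) < 1"
    by (auto simp: eventually_sequentially)
  have "(\<integral>\<^sup>+x. ennreal (\<bar>\<phi> k x + - (\<phi> k x - u x)\<bar> powr ?s) \<partial>lborel) < \<infinity>"
  proof (rule nn_integral_powr_add_finite)
    show "(\<integral>\<^sup>+x. ennreal (\<bar>\<phi> k x\<bar> powr ?s) \<partial>lborel) < \<infinity>"
      by (rule nn_integral_powr_finite_smooth_cs[OF c1 bd s])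
    show "(\<integral>\<^sup>+x. ennreal (\<bar>- (\<phi> k x - u x)\<bar> powr ?s) \<partial>lborel) < \<infinity>"
      using k by (simp add: abs_minus_commute less_le_trans)
  qed (use s in auto)
  then show "(\<integral>\<^sup>+x. ennreal (\<bar>u x\<bar> powr ?s) \<partial>lborel) < \<infinity>" by simp
  have "\<forall>\<^sub>F k in sequentially. (\<integral>\<^sup>+ x. ennreal ((norm (grad (\<phi> k) x - G x))\<^sup>2) \<partial>lborel) < 1"
    using lim1 by (rule order_tendstoD) simp
  then obtain k where k: "(\<integral>\<^sup>+ x. ennreal ((norm (grad (\<phi> k) x - G x))\<^sup>2) \<partial>lborel) < 1"
    by (auto simp: eventually_sequentially)
  have pw: "\<bar>y\<bar> powr 2 = y\<^sup>2" for y :: real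
    by (cases "y = 0") (auto simp: powr_numeral)
  have "(\<integral>\<^sup>+x. ennreal (\<bar>norm (grad (\<phi> k) x) + norm (grad (\<phi> k) x - G x)\<bar> powr 2) \<partial>lborel) < \<infinity>"
  proof (rule nn_integral_powr_add_finite)
    have "grad (\<phi> k) x = 0" if "x \<in> - closure {x. \<phi> k x \<noteq> 0}" for x
      by (rule grad_eq_0_outside[OF _ that]) (use closure_subset[of "{x. \<phi> k x \<noteq> 0}"] in auto)
    then have "{x. norm (grad (\<phi> k) x) \<noteq> 0} \<subseteq> closure {x. \<phi> k x \<noteq> 0}" by force
    then have "bounded {x. norm (grad (\<phi> k) x) \<noteq> 0}" using bd bounded_subset bounded_closure by blast
    then show "(\<integral>\<^sup>+x. ennreal (\<bar>norm (grad (\<phi> k) x)\<bar> powr 2) \<partial>lborel) < \<infinity>"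
      by (intro nn_integral_powr_finite_smooth_cs continuous_on_norm c2) auto
    show "(\<integral>\<^sup>+x. ennreal (\<bar>norm (grad (\<phi> k) x - G x)\<bar> powr 2) \<partial>lborel) < \<infinity>"
      using k by (simp add: pw less_le_trans)
  qed auto
  moreover have "(\<integral>\<^sup>+x. ennreal ((norm (G x))\<^sup>2) \<partial>lborel)
     \<le> (\<integral>\<^sup>+x. ennreal (\<bar>norm (grad (\<phi> k) x) + norm (grad (\<phi> k) x - G x)\<bar> powr 2) \<partial>lborel)"
    unfolding pw
  proof (intro nn_integral_mono ennreal_leI power_mono)
    fix x
    show "norm (G x) \<le> norm (grad (\<phi> k) x) + norm (grad (\<phi> k) x - G x)"
      using norm_triangle_ineq4[of "grad (\<phi> k) x" "grad (\<phi> k) x - G x"] by simp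
  qed auto
  ultimately show "(\<integral>\<^sup>+x. ennreal ((norm (G x))\<^sup>2) \<partial>lborel) < \<infinity>"
    by (rule le_less_trans[rotated])
qed

lemma Holder_tendsto_0:
  fixes f :: "nat \<Rightarrow> 'a \<Rightarrow> real" and g :: "'a \<Rightarrow> real"
  assumes [measurable]: "\<And>k. f k \<in> borel_measurable M" "g \<in> borel_measurable M"
    and nonneg: "\<And>k x. f k x \<ge> 0" "\<And>x. g x \<ge> 0"
    and pq: "p > 1" "q > 1" "1 / p + 1 / q = 1"
    and f: "(\<lambda>k. \<integral>\<^sup>+x. ennreal (f k x powr p) \<partial>M) \<longlonglongrightarrow> 0"
    and g: "(\<integral>\<^sup>+x. ennreal (g x powr q) \<partial>M) < \<infinity>"
  shows "(\<lambda>k. \<integral>\<^sup>+x. ennreal (f k x * g x) \<partial>M) \<longlonglongrightarrow> 0"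
proof -
  define A where "A k = (\<integral>\<^sup>+x. ennreal (f k x powr p) \<partial>M)" for k
  define B where "B = enn2real (\<integral>\<^sup>+x. ennreal (g x powr q) \<partial>M)"
  have B: "(\<integral>\<^sup>+x. ennreal (g x powr q) \<partial>M) = ennreal B" "B \<ge> 0"
    using g by (auto simp: B_def less_top)
  have A0: "(\<lambda>k. enn2real (A k)) \<longlonglongrightarrow> 0"
    using tendsto_enn2real[of A 0 sequentially] f by (simp add: A_def[abs_def])
  have "(\<lambda>k. enn2real (A k) powr (1/p)) \<longlonglongrightarrow> 0 powr (1/p)"
    by (rule tendsto_powr'[OF A0 tendsto_const]) (use pq in auto)
  then have "(\<lambda>k. ennreal (enn2real (A k) powr (1/p) * B powr (1/q))) \<longlonglongrightarrow> ennreal (0 * B powr (1/q))"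
    by (intro tendsto_ennrealI tendsto_mult tendsto_const) simp
  then have lim: "(\<lambda>k. ennreal (enn2real (A k) powr (1/p) * B powr (1/q))) \<longlonglongrightarrow> 0" by simp
  \<comment> \<open>\<open>enn2real\<close> sends \<infinity> to 0, so the bound in terms of
    \<open>enn2real (A k)\<close> is claimed only once \<open>A k\<close> is known to be
    finite.\<close>
  have "\<forall>\<^sub>F k in sequentially. A k < 1"
    using f unfolding A_def by (rule order_tendstoD) simp
  then have "\<forall>\<^sub>F k in sequentially. (\<integral>\<^sup>+x. ennreal (f k x * g x) \<partial>M) \<le> ennreal (enn2real (A k) powr (1/p) * B powr (1/q))"
  proof eventually_elim
    case (elim k)
    then have "A k = ennreal (enn2real (A k))" by (simp add: less_le_trans less_top)
    then show ?case
      using B nonneg pq by (intro nn_integral_Holder) (auto simp: A_def)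
  qed
  then show ?thesis
    by (intro tendsto_sandwich[OF _ _ tendsto_const lim]) auto
qed

lemma L1_limit:
  fixes f :: "nat \<Rightarrow> 'a \<Rightarrow> real"
  assumes [measurable]: "g \<in> borel_measurable M" and f: "\<And>k. integrable M (f k)"
    and lim: "(\<lambda>k. \<integral>\<^sup>+x. ennreal \<bar>f k x - g x\<bar> \<partial>M) \<longlonglongrightarrow> 0"
  shows "integrable M g" "(\<lambda>k. \<integral>x. f k x \<partial>M) \<longlonglongrightarrow> (\<integral>x. g x \<partial>M)"
proof -
  have [measurable]: "f k \<in> borel_measurable M" for k using f by auto
  have "\<forall>\<^sub>F k in sequentially. (\<integral>\<^sup>+x. ennreal \<bar>f k x - g x\<bar> \<partial>M) < 1"
    using lim by (rule order_tendstoD) simp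
  then obtain k where k: "(\<integral>\<^sup>+x. ennreal \<bar>f k x - g x\<bar> \<partial>M) < 1"
    by (auto simp: eventually_sequentially)
  then have "integrable M (\<lambda>x. f k x - g x)"
    by (intro integrableI_bounded) (auto simp: less_le_trans)
  then have "integrable M (\<lambda>x. f k x - (f k x - g x))"
    by (rule Bochner_Integration.integrable_diff[OF f])
  moreover have "(\<lambda>x. f k x - (f k x - g x)) = g" by (simp add: fun_eq_iff)
  ultimately show g: "integrable M g" by (simp only:)
  show "(\<lambda>k. \<integral>x. f k x \<partial>M) \<longlonglongrightarrow> (\<integral>x. g x \<partial>M)"
    using f g lim by (intro tendsto_L1_int) auto
qed

text \<open>Only u is approximated; U keeps its full support and enters through two dual bounds.
  Gradients pair in L^2 with L^2, and u pairs with the Laplacian in the Sobolev exponent 2n/(n - 2)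
  and its conjugate 2n/(n + 2), so both sides of the smooth identity converge.\<close>

lemma Green_D12:
  fixes u U :: "real^'n \<Rightarrow> real"
  assumes D: "D12 u G" and n3: "CARD('n) \<ge> 3" and U: "Ck 2 U"
    and gU: "(\<integral>\<^sup>+x. ennreal ((norm (grad U x))\<^sup>2) \<partial>lborel) < \<infinity>"
    and lU: "(\<integral>\<^sup>+x. ennreal (\<bar>laplacian U x\<bar> powr (2 * real CARD('n) / (real CARD('n) + 2))) \<partial>lborel) < \<infinity>"
  shows "integrable lborel (\<lambda>x. G x \<bullet> grad U x)" "integrable lborel (\<lambda>x. u x * laplacian U x)"
    "(\<integral>x. G x \<bullet> grad U x \<partial>lborel) = - (\<integral>x. u x * laplacian U x \<partial>lborel)"
proof -
  let ?n = "real CARD('n)"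
  let ?s = "sob_exp TYPE('n)"
  have n: "?n \<ge> 3" using n3 by simp
  obtain \<phi> where phi: "\<And>k. smooth_cs (\<phi> k)"
    and lim1: "(\<lambda>k. \<integral>\<^sup>+ x. ennreal ((norm (grad (\<phi> k) x - G x))\<^sup>2) \<partial>lborel) \<longlonglongrightarrow> 0"
    and lim2: "(\<lambda>k. \<integral>\<^sup>+ x. ennreal (\<bar>\<phi> k x - u x\<bar> powr ?s) \<partial>lborel) \<longlonglongrightarrow> 0"
    and [measurable]: "u \<in> borel_measurable borel" "G \<in> borel_measurable borel"
    using D by (auto simp: D12_def)
  have Ck: "Ck k (\<phi> m)" for k m using phi by (auto simp: smooth_cs_def)
  have c1: "continuous_on UNIV (\<phi> k)" and c2: "continuous_on UNIV (grad (\<phi> k))" for k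
    using Ck[of 0 k] continuous_on_grad[OF Ck[of "Suc 0" k]] by auto
  have [measurable]: "\<phi> k \<in> borel_measurable borel" "grad (\<phi> k) \<in> borel_measurable borel" for k
    using c1 c2 by (auto intro: borel_measurable_continuous_onI)
  have Ui: "Ck 1 (\<lambda>y. grad U y $ i)" for i using U by (simp add: numeral_2_eq_2)
  have lap: "laplacian U x = (\<Sum>i\<in>UNIV. grad (\<lambda>y. grad U y $ i) x $ i)" for x
    by (simp add: laplacian_def grad_def)
  have "continuous_on UNIV (laplacian U)"
    unfolding lap[abs_def] using Ui by (intro continuous_on_sum) auto
  moreover have "continuous_on UNIV (grad U)"
    using U by (intro continuous_on_grad[of 1]) (simp add: numeral_2_eq_2)
  ultimately have [measurable]: "grad U \<in> borel_measurable borel" "laplacian U \<in> borel_measurable borel"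
    by (auto intro: borel_measurable_continuous_onI)
  note G = Green_smooth_cs[OF phi U]
  have "(\<lambda>k. \<integral>\<^sup>+x. ennreal (norm (grad (\<phi> k) x - G x) * norm (grad U x)) \<partial>lborel) \<longlonglongrightarrow> 0"
  proof (rule Holder_tendsto_0[where p = 2 and q = 2])
    have pw: "norm v powr 2 = (norm v)\<^sup>2" for v :: "real^'n"
      using powr_realpow'[of "norm v" 2] by simp
    show "(\<lambda>k. \<integral>\<^sup>+x. ennreal (norm (grad (\<phi> k) x - G x) powr 2) \<partial>lborel) \<longlonglongrightarrow> 0"
      unfolding pw by (rule lim1)
    show "(\<integral>\<^sup>+x. ennreal (norm (grad U x) powr 2) \<partial>lborel) < \<infinity>"
      unfolding pw by (rule gU)
  qed auto
  then have 1: "(\<lambda>k. \<integral>\<^sup>+x. ennreal \<bar>grad (\<phi> k) x \<bullet> grad U x - G x \<bullet> grad U x\<bar> \<partial>lborel) \<longlonglongrightarrow> 0"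
  proof (rule tendsto_sandwich[OF _ _ tendsto_const, rotated 2])
    show "\<forall>\<^sub>F k in sequentially. (\<integral>\<^sup>+x. ennreal \<bar>grad (\<phi> k) x \<bullet> grad U x - G x \<bullet> grad U x\<bar> \<partial>lborel)
      \<le> (\<integral>\<^sup>+x. ennreal (norm (grad (\<phi> k) x - G x) * norm (grad U x)) \<partial>lborel)"
      by (intro always_eventually allI nn_integral_mono ennreal_leI)
        (subst inner_diff_left[symmetric], rule Cauchy_Schwarz_ineq2)
  qed simp
  have "(\<lambda>k. \<integral>\<^sup>+x. ennreal (\<bar>\<phi> k x - u x\<bar> * \<bar>laplacian U x\<bar>) \<partial>lborel) \<longlonglongrightarrow> 0"
    using lim2 lU n by (intro Holder_tendsto_0[where p = ?s and q = "2 * ?n / (?n + 2)"])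
     (auto simp: sob_exp_def dimN_def simp flip: add_divide_distrib)
  then have 2: "(\<lambda>k. \<integral>\<^sup>+x. ennreal \<bar>\<phi> k x * laplacian U x - u x * laplacian U x\<bar> \<partial>lborel) \<longlonglongrightarrow> 0"
    by (simp add: abs_mult flip: left_diff_distrib)
  note L1 = L1_limit[OF _ G(1) 1] and L2 = L1_limit[OF _ G(2) 2]
  show "integrable lborel (\<lambda>x. G x \<bullet> grad U x)" by (rule L1) measurable
  show "integrable lborel (\<lambda>x. u x * laplacian U x)" by (rule L2) measurable
  have a: "(\<lambda>k. \<integral>x. grad (\<phi> k) x \<bullet> grad U x \<partial>lborel) \<longlonglongrightarrow> (\<integral>x. G x \<bullet> grad U x \<partial>lborel)"
    by (rule L1) measurable
  have "(\<lambda>k. \<integral>x. \<phi> k x * laplacian U x \<partial>lborel) \<longlonglongrightarrow> (\<integral>x. u x * laplacian U x \<partial>lborel)"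
    by (rule L2) measurable
  then have "(\<lambda>k. - (\<integral>x. \<phi> k x * laplacian U x \<partial>lborel)) \<longlonglongrightarrow> - (\<integral>x. u x * laplacian U x \<partial>lborel)"
    by (rule tendsto_minus)
  with a show "(\<integral>x. G x \<bullet> grad U x \<partial>lborel) = - (\<integral>x. u x * laplacian U x \<partial>lborel)"
    unfolding G(3) by (rule LIMSEQ_unique)
qed

section \<open>Talenti bubbles\<close>

lemma bden_has_derivative:
  "(bden \<xi> lam has_derivative (\<lambda>h. 2 * lam\<^sup>2 * ((x - \<xi>) \<bullet> h))) (at (x :: 'a::real_inner))"
  unfolding bden_def power2_norm_eq_inner
  by (auto intro!: derivative_eq_intros simp: inner_commute algebra_simps)

lemma bden_powr_has_derivative:
  "((\<lambda>x. bden \<xi> lam x powr a) has_derivative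
    (\<lambda>h. a * bden \<xi> lam x powr (a - 1) * (2 * lam\<^sup>2 * ((x - \<xi>) \<bullet> h)))) (at (x :: 'a::real_inner))"
proof -
  have "((\<lambda>s. s powr a) has_derivative (*) (a * bden \<xi> lam x powr (a - 1))) (at (bden \<xi> lam x))"
    using has_real_derivative_powr[OF bden_pos[of \<xi> lam x], of a] by (simp add: has_field_derivative_def)
  from has_derivative_compose[OF bden_has_derivative this] show ?thesis .
qed

lemma Ck_bden: "Ck k (bden \<xi> lam :: real^'n \<Rightarrow> real)"
proof -
  have "bden \<xi> lam = (\<lambda>x. 1 + lam\<^sup>2 * (\<Sum>i\<in>UNIV. (x $ i + - \<xi> $ i) * (x $ i + - \<xi> $ i)))"
    by (simp add: bden_def fun_eq_iff power2_norm_eq_inner inner_vec_def)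
  moreover have "Ck k (\<lambda>x. 1 + lam\<^sup>2 * (\<Sum>i\<in>UNIV. (x $ i + - \<xi> $ i) * (x $ i + - \<xi> $ i)))"
    by (intro Ck_add Ck_mult Ck_sum Ck_const Ck_coordinate)
  ultimately show ?thesis by simp
qed

lemma Ck_bubble_profile:
  assumes "lam > 0"
  shows "Ck k (bubble_profile \<xi> lam)"
  unfolding bubble_profile_eq_bden[OF assms, abs_def]
  by (intro Ck_mult Ck_const Ck_powr Ck_bden bden_pos)

lemma bubble_profile_pos:
  assumes "lam > 0"
  shows "bubble_profile \<xi> lam x > 0"
  using assms bden_pos[of \<xi> lam x] by (simp add: bubble_profile_eq_bden)

lemma grad_bubble_profile:
  fixes \<xi> :: "real^'n"
  assumes "lam > 0"
  shows "grad (bubble_profile \<xi> lam) x = (- (real CARD('n) - 2) * lam powr ((real CARD('n) + 2) / 2)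
     * bden \<xi> lam x powr (- real CARD('n) / 2)) *\<^sub>R (x - \<xi>)"
proof -
  let ?n = "real CARD('n)"
  have e: "- (?n - 2) / 2 - 1 = - ?n / 2" by (simp add: field_simps)
  have "lam powr ((?n - 2) / 2) * lam\<^sup>2 = lam powr ((?n - 2) / 2) * lam powr 2"
    using assms by (simp add: powr_numeral)
  also have "\<dots> = lam powr ((?n + 2) / 2)" by (simp add: powr_add[symmetric] field_simps)
  finally have l: "lam powr ((?n - 2) / 2) * lam\<^sup>2 = lam powr ((?n + 2) / 2)" .
  have "(bubble_profile \<xi> lam has_derivative (\<lambda>h. lam powr ((?n - 2) / 2) *
      (- (?n - 2) / 2 * bden \<xi> lam x powr (- (?n - 2) / 2 - 1) * (2 * lam\<^sup>2 * ((x - \<xi>) \<bullet> h))))) (at x)"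
    unfolding bubble_profile_eq_bden[OF assms, abs_def]
    by (intro has_derivative_mult_right bden_powr_has_derivative)
  moreover have "(\<lambda>h. lam powr ((?n - 2) / 2) *
      (- (?n - 2) / 2 * bden \<xi> lam x powr (- (?n - 2) / 2 - 1) * (2 * lam\<^sup>2 * ((x - \<xi>) \<bullet> h))))
    = (\<lambda>h. ((- (?n - 2) * lam powr ((?n + 2) / 2) * bden \<xi> lam x powr (- ?n / 2)) *\<^sub>R (x - \<xi>)) \<bullet> h)"
    unfolding e l[symmetric] inner_scaleR_left by (simp add: fun_eq_iff field_simps)
  ultimately have "(bubble_profile \<xi> lam has_derivative (\<lambda>h. ((- (?n - 2) * lam powr ((?n + 2) / 2)
     * bden \<xi> lam x powr (- ?n / 2)) *\<^sub>R (x - \<xi>)) \<bullet> h)) (at x)"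
    by (simp only:)
  then show ?thesis by (rule grad_eq)
qed

text \<open>Up to the common factor \<open>K * q\<close>, the i-th pure second derivative is Q - n
  lam^2 (x_i - \<xi>_i)^2. In the sum over i the quadratic terms cancel against those of n Q and
  leave the constant n. This cancellation is what makes the Laplacian a single power of Q.\<close>

lemma laplacian_bubble_profile:
  fixes \<xi> :: "real^'n"
  assumes "lam > 0"
  shows "laplacian (bubble_profile \<xi> lam) x = - real CARD('n) * (real CARD('n) - 2)
    * lam powr ((real CARD('n) + 2) / 2) * bden \<xi> lam x powr (- (real CARD('n) + 2) / 2)"
proof -
  let ?n = "real CARD('n)"
  define K where "K = - (?n - 2) * lam powr ((?n + 2) / 2)"
  define q where "q = bden \<xi> lam x powr (- (?n + 2) / 2)"
  have e: "- ?n / 2 - 1 = - (?n + 2) / 2" by (simp add: field_simps)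
  have q: "bden \<xi> lam x powr (- ?n / 2) = bden \<xi> lam x * q"
  proof -
    have "bden \<xi> lam x * q = bden \<xi> lam x powr 1 * q" using bden_pos[of \<xi> lam x] by simp
    also have "\<dots> = bden \<xi> lam x powr (- ?n / 2)"
      unfolding q_def powr_add[symmetric] by (simp add: field_simps)
    finally show ?thesis by simp
  qed
  have gi: "grad (bubble_profile \<xi> lam) y $ i = K * (bden \<xi> lam y powr (- ?n / 2) * (y $ i - \<xi> $ i))" for y i
    by (simp add: grad_bubble_profile[OF assms] K_def)
  have d: "((\<lambda>y. grad (bubble_profile \<xi> lam) y $ i) has_derivative
     (\<lambda>h. K * (bden \<xi> lam x powr (- ?n / 2) * h $ i
       + (- ?n / 2 * bden \<xi> lam x powr (- ?n / 2 - 1) * (2 * lam\<^sup>2 * ((x - \<xi>) \<bullet> h))) * (x $ i - \<xi> $ i)))) (at x)" for i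
    unfolding gi
    by (intro has_derivative_mult_right has_derivative_mult bden_powr_has_derivative)
      (auto intro!: derivative_eq_intros bounded_linear_imp_has_derivative bounded_linear_vec_nth)
  have "grad (\<lambda>y. grad (bubble_profile \<xi> lam) y $ i) x $ i
     = K * q * (bden \<xi> lam x - ?n * lam\<^sup>2 * (x $ i - \<xi> $ i)\<^sup>2)" for i
    unfolding grad_nth_eq[OF d] q e q_def[symmetric]
    by (simp add: inner_axis power2_eq_square algebra_simps)
  then have "laplacian (bubble_profile \<xi> lam) x
     = K * q * (\<Sum>i\<in>(UNIV::'n set). (bden \<xi> lam x - ?n * lam\<^sup>2 * (x $ i - \<xi> $ i)\<^sup>2))"
    by (simp add: laplacian_def grad_def sum_distrib_left)
  also have "(\<Sum>i\<in>(UNIV::'n set). (bden \<xi> lam x - ?n * lam\<^sup>2 * (x $ i - \<xi> $ i)\<^sup>2))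
     = ?n * bden \<xi> lam x - ?n * (lam\<^sup>2 * (norm (x - \<xi>))\<^sup>2)"
  proof -
    have "(norm (x - \<xi>))\<^sup>2 = (\<Sum>i\<in>(UNIV::'n set). (x $ i - \<xi> $ i)\<^sup>2)"
      unfolding power2_norm_eq_inner by (simp add: inner_vec_def power2_eq_square)
    then show ?thesis by (simp add: sum_subtractf mult.assoc flip: sum_distrib_left)
  qed
  also have "\<dots> = ?n" by (simp add: bden_def algebra_simps)
  finally show ?thesis by (simp add: K_def q_def algebra_simps)
qed

lemma nn_integral_bden_powr_finite:
  fixes \<xi> :: "'a::euclidean_space"
  assumes "lam > 0" "real DIM('a) < 2 * b"
  shows "(\<integral>\<^sup>+x. ennreal (bden \<xi> lam x powr (-b)) \<partial>lborel) < \<infinity>"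
proof -
  obtain C where "\<And>(\<xi>::'a) lam. lam > 0 \<Longrightarrow>
    (\<integral>\<^sup>+x. ennreal (bden \<xi> lam x powr (-b)) \<partial>lborel) \<le> ennreal (C * lam powr (- real DIM('a)))"
    using nn_integral_bden_powr[OF assms(2)] by blast
  from this[OF assms(1), of \<xi>] show ?thesis by (rule le_less_trans) simp
qed

lemma nn_integral_mult_bden_powr_finite:
  fixes \<xi> :: "'a::euclidean_space"
  assumes "lam > 0" "real DIM('a) < 2 * b" "\<And>x. f x \<le> C * bden \<xi> lam x powr (-b)"
  shows "(\<integral>\<^sup>+x. ennreal (f x) \<partial>lborel) < \<infinity>"
proof -
  have "f x \<le> \<bar>C\<bar> * bden \<xi> lam x powr (-b)" for x
    by (rule order_trans[OF assms(3)]) (simp add: mult_right_mono)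
  then have "(\<integral>\<^sup>+x. ennreal (f x) \<partial>lborel) \<le> (\<integral>\<^sup>+x. ennreal \<bar>C\<bar> * ennreal (bden \<xi> lam x powr (-b)) \<partial>lborel)"
    by (intro nn_integral_mono) (simp add: ennreal_leI flip: ennreal_mult')
  also have "\<dots> = ennreal \<bar>C\<bar> * (\<integral>\<^sup>+x. ennreal (bden \<xi> lam x powr (-b)) \<partial>lborel)"
    by (rule nn_integral_cmult) measurable
  also have "\<dots> < \<infinity>"
    using nn_integral_bden_powr_finite[OF assms(1,2), of \<xi>] by (simp add: ennreal_mult_less_top)
  finally show ?thesis .
qed

context
  fixes \<xi> :: "real^'n" and lam :: real
  assumes n3: "CARD('n) \<ge> 3" and lam: "lam > 0"
begin

lemma nn_integral_bubble_profile_finite: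
  "(\<integral>\<^sup>+x. ennreal (\<bar>c * bubble_profile \<xi> lam x\<bar> powr sob_exp TYPE('n)) \<partial>lborel) < \<infinity>"
proof (rule nn_integral_mult_bden_powr_finite[OF lam])
  let ?n = "real CARD('n)"
  have n: "?n \<ge> 3" using n3 by simp
  show "real DIM(real^'n) < 2 * ?n" using n by simp
  fix x
  have "- (?n - 2) / 2 * sob_exp TYPE('n) = - ?n"
    using n by (simp add: sob_exp_def dimN_def field_simps)
  then show "\<bar>c * bubble_profile \<xi> lam x\<bar> powr sob_exp TYPE('n)
    \<le> \<bar>c * lam powr ((?n - 2) / 2)\<bar> powr sob_exp TYPE('n) * bden \<xi> lam x powr (- ?n)"
    by (simp add: bubble_profile_eq_bden[OF lam] abs_mult powr_mult powr_powr)
qed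

text \<open>The factor |x - \<xi>|^2 \<le> Q / lam^2 costs one power of Q, leaving Q^(-(n-1)); this
  is integrable because n - 1 > n/2 for n > 2.\<close>

lemma nn_integral_grad_bubble_profile_finite:
  "(\<integral>\<^sup>+x. ennreal ((norm (grad (bubble_profile \<xi> lam) x))\<^sup>2) \<partial>lborel) < \<infinity>"
proof (rule nn_integral_mult_bden_powr_finite[OF lam])
  let ?n = "real CARD('n)"
  let ?K = "- (?n - 2) * lam powr ((?n + 2) / 2)"
  have n: "?n \<ge> 3" using n3 by simp
  show "real DIM(real^'n) < 2 * (?n - 1)" using n by simp
  fix x
  have "(norm (grad (bubble_profile \<xi> lam) x))\<^sup>2 = ?K\<^sup>2 * (bden \<xi> lam x powr (- ?n / 2))\<^sup>2 * (norm (x - \<xi>))\<^sup>2"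
    by (simp add: grad_bubble_profile[OF lam] power_mult_distrib)
  also have "\<dots> \<le> ?K\<^sup>2 * (bden \<xi> lam x powr (- ?n / 2))\<^sup>2 * (bden \<xi> lam x / lam\<^sup>2)"
    using lam by (intro mult_left_mono) (auto simp: bden_def field_simps)
  also have "\<dots> = ?K\<^sup>2 / lam\<^sup>2 * ((bden \<xi> lam x powr (- ?n / 2))\<^sup>2 * bden \<xi> lam x)" by simp
  also have "(bden \<xi> lam x powr (- ?n / 2))\<^sup>2 * bden \<xi> lam x
     = bden \<xi> lam x powr (- ?n / 2) * bden \<xi> lam x powr (- ?n / 2) * bden \<xi> lam x powr 1"
    using bden_pos[of \<xi> lam x] by (simp add: power2_eq_square)
  also have "\<dots> = bden \<xi> lam x powr (- (?n - 1))"
    unfolding powr_add[symmetric] by (simp add: field_simps)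
  finally show "(norm (grad (bubble_profile \<xi> lam) x))\<^sup>2 \<le> ?K\<^sup>2 / lam\<^sup>2 * bden \<xi> lam x powr (- (?n - 1))" .
qed

lemma nn_integral_laplacian_bubble_profile_finite:
  "(\<integral>\<^sup>+x. ennreal (\<bar>laplacian (bubble_profile \<xi> lam) x\<bar> powr
     (2 * real CARD('n) / (real CARD('n) + 2))) \<partial>lborel) < \<infinity>"
proof (rule nn_integral_mult_bden_powr_finite[OF lam])
  let ?n = "real CARD('n)"
  let ?s = "2 * ?n / (?n + 2)"
  let ?K = "\<bar>- ?n * (?n - 2) * lam powr ((?n + 2) / 2)\<bar>"
  show "real DIM(real^'n) < 2 * ?n" using n3 by simp
  fix x
  have e: "- (?n + 2) / 2 * ?s = - ?n" by (simp add: field_simps)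
  have "\<bar>laplacian (bubble_profile \<xi> lam) x\<bar> = ?K * bden \<xi> lam x powr (- (?n + 2) / 2)"
    by (simp add: laplacian_bubble_profile[OF lam] abs_mult)
  then show "\<bar>laplacian (bubble_profile \<xi> lam) x\<bar> powr ?s \<le> ?K powr ?s * bden \<xi> lam x powr (- ?n)"
    by (simp only: powr_mult powr_powr e)
qed

end

section \<open>Truncation of small values and membership of bubbles in the energy space\<close>

lemma flat_cutoff_bounds: "0 \<le> flat_cutoff y" "flat_cutoff y \<le> 1"
  by (auto simp: flat_cutoff_def)

text \<open>The factor by which \<open>t \<mapsto> t * flat_cutoff (s * t - 1)\<close> multiplies a gradient at
  \<open>y = s * t - 1\<close>; at \<open>y \<le> 0\<close> the cutoff vanishes, so the junk value of the quotient at \<open>0\<close> is harmless.\<close>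
definition cutoff_slope :: "real \<Rightarrow> real" where
  "cutoff_slope y = flat_cutoff y * (1 + (y + 1) / y\<^sup>2)"

text \<open>For y > 0 and z = 1/y the slope is (1 + z + z^2) e^(-z), and e^z \<ge> 1 + z + z^2/2
  yields the bound 2. The range from 0 to 2 is exactly what is wanted: the slope then differs from 1
  by at most 1, so the error in the gradient is dominated by the gradient itself.\<close>

lemma cutoff_slope_bounds: "0 \<le> cutoff_slope y" "cutoff_slope y \<le> 2"
proof -
  have "0 \<le> cutoff_slope y \<and> cutoff_slope y \<le> 2"
  proof (cases "y > 0")
    case True
    define z where "z = 1 / y"
    have z: "z > 0" using True by (simp add: z_def)
    have eq: "cutoff_slope y = (1 + z + z\<^sup>2) / exp z"
      using True by (simp add: cutoff_slope_def flat_cutoff_def z_def exp_minus field_simps power2_eq_square)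
    have "1 + z + z\<^sup>2 \<le> 2 * exp z"
      using exp_lower_Taylor_quadratic[of z] z by simp
    then show ?thesis using z by (simp add: eq add_nonneg_nonneg pos_divide_le_eq)
  qed (simp add: cutoff_slope_def flat_cutoff_def)
  then show "0 \<le> cutoff_slope y" "cutoff_slope y \<le> 2" by auto
qed

lemma flat_cutoff_tendsto_1: "(flat_cutoff \<longlongrightarrow> 1) at_top"
proof -
  have "((\<lambda>y::real. exp (- inverse y)) \<longlongrightarrow> exp (- 0)) at_top"
    by (intro tendsto_intros tendsto_inverse_0_at_top filterlim_ident)
  then have "((\<lambda>y::real. exp (- inverse y)) \<longlongrightarrow> 1) at_top" by simp
  then show ?thesis
    by (rule Lim_transform_eventually)
      (use eventually_gt_at_top[of "0::real"] in \<open>eventually_elim, simp add: flat_cutoff_def inverse_eq_divide\<close>)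
qed

lemma cutoff_slope_tendsto_1: "(cutoff_slope \<longlongrightarrow> 1) at_top"
proof -
  have inv: "(inverse \<longlongrightarrow> (0::real)) at_top"
    by (rule tendsto_inverse_0_at_top[OF filterlim_ident])
  have "((\<lambda>y. flat_cutoff y * (1 + (inverse y + (inverse y)\<^sup>2))) \<longlongrightarrow> 1 * (1 + (0 + 0\<^sup>2))) at_top"
    by (intro tendsto_intros flat_cutoff_tendsto_1 inv)
  then have "((\<lambda>y. flat_cutoff y * (1 + (inverse y + (inverse y)\<^sup>2))) \<longlongrightarrow> 1) at_top" by simp
  then show ?thesis
    by (rule Lim_transform_eventually)
      (use eventually_gt_at_top[of "0::real"] in
        \<open>eventually_elim, simp add: cutoff_slope_def field_simps power2_eq_square\<close>)
qed

lemma filterlim_cutoff_argument: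
  assumes "t > 0"
  shows "filterlim (\<lambda>k. real (Suc k) * t - 1) at_top sequentially"
proof -
  have "filterlim (\<lambda>k. real (Suc k)) at_top sequentially"
    by (rule filterlim_compose[OF filterlim_real_sequentially filterlim_Suc])
  then have "filterlim (\<lambda>k. t * real (Suc k)) at_top sequentially"
    using assms by (intro filterlim_tendsto_pos_mult_at_top[OF tendsto_const])
  then have "filterlim (\<lambda>k. - 1 + t * real (Suc k)) at_top sequentially"
    by (rule filterlim_tendsto_add_at_top[OF tendsto_const])
  then show ?thesis by (simp add: mult.commute)
qed

lemma grad_scale:
  assumes "Ck 1 U"
  shows "grad (\<lambda>x. c * U x) x = c *\<^sub>R grad U x"
proof (rule grad_eq)
  have "(U has_derivative (\<lambda>h. grad U x \<bullet> h)) (at x)"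
    using assms by (intro grad_has_derivative) simp
  then show "((\<lambda>x. c * U x) has_derivative (\<lambda>h. (c *\<^sub>R grad U x) \<bullet> h)) (at x)"
    by (auto intro: has_derivative_mult_right)
qed

text \<open>Cutting off in the range of \<open>U\<close> rather than in space makes the approximating gradients
  multiples of \<open>grad U\<close>, so that dominated convergence applies with no error term.\<close>
lemma D12_of_vanishing_at_infinity:
  fixes U :: "real^'n \<Rightarrow> real"
  assumes n3: "CARD('n) \<ge> 3" and Ck: "\<And>k. Ck k U" and pos: "\<And>x. U x > 0"
    and van: "\<And>\<epsilon>. \<epsilon> > 0 \<Longrightarrow> bounded {x. U x > \<epsilon>}"
    and gU: "(\<integral>\<^sup>+x. ennreal ((norm (grad U x))\<^sup>2) \<partial>lborel) < \<infinity>"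
    and iU: "(\<integral>\<^sup>+x. ennreal (\<bar>c * U x\<bar> powr sob_exp TYPE('n)) \<partial>lborel) < \<infinity>"
  shows "D12 (\<lambda>x. c * U x) (\<lambda>x. c *\<^sub>R grad U x)"
proof -
  let ?s = "sob_exp TYPE('n)"
  have s: "?s > 0" using n3 by (simp add: sob_exp_def dimN_def)
  \<comment> \<open>\<open>y k\<close> is positive exactly where U > 1/(k + 1), a bounded set, which
    gives the truncations bounded support; since U > 0 it tends to infinity at every point, where
    the cutoff tends to 1.\<close>
  define y where "y k x = real (Suc k) * U x - 1" for k x
  define \<phi> where "\<phi> k x = c * (U x * flat_cutoff (y k x))" for k x
  have Cky: "Ck m (y k)" for m k
  proof -
    have "Ck m (\<lambda>x. real (Suc k) * U x + - 1)" by (intro Ck_add Ck_mult Ck_const Ck)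
    then show ?thesis by (simp add: y_def[abs_def])
  qed
  have Ckphi: "Ck m (\<phi> k)" for m k
    unfolding \<phi>_def by (intro Ck_mult Ck_const Ck Ck_flat_cutoff Cky)
  have "{x. \<phi> k x \<noteq> 0} \<subseteq> {x. U x > 1 / real (Suc k)}" for k
    by (auto simp: \<phi>_def flat_cutoff_def y_def field_simps split: if_splits)
  then have smooth: "smooth_cs (\<phi> k)" for k
    using Ckphi van[of "1 / real (Suc k)"] by (auto simp: smooth_cs_def intro: bounded_subset)
  have gphi: "grad (\<phi> k) x = (c * cutoff_slope (y k x)) *\<^sub>R grad U x" for k x
  proof (rule grad_eq)
    have dU: "(U has_derivative (\<lambda>h. grad U x \<bullet> h)) (at x)"
      using Ck[of 1] by (intro grad_has_derivative) simp
    have dy: "(y k has_derivative (\<lambda>h. real (Suc k) * (grad U x \<bullet> h))) (at x)"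
      unfolding y_def by (auto intro!: derivative_eq_intros dU)
    have "(flat_cutoff has_derivative (*) (flat_cutoff (y k x) / (y k x)\<^sup>2)) (at (y k x))"
      using flat_cutoff_has_derivative by (simp add: has_field_derivative_def)
    note dc = has_derivative_compose[OF dy this]
    have "(\<phi> k has_derivative (\<lambda>h. c * (U x * (flat_cutoff (y k x) / (y k x)\<^sup>2 * (real (Suc k) * (grad U x \<bullet> h)))
        + (grad U x \<bullet> h) * flat_cutoff (y k x)))) (at x)"
      unfolding \<phi>_def by (intro has_derivative_mult_right has_derivative_mult dU dc)
    moreover have "c * (U x * (flat_cutoff (y k x) / (y k x)\<^sup>2 * (real (Suc k) * (grad U x \<bullet> h)))
        + (grad U x \<bullet> h) * flat_cutoff (y k x)) = ((c * cutoff_slope (y k x)) *\<^sub>R grad U x) \<bullet> h" for h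
    proof -
      \<comment> \<open>The factor k + 1 from the chain rule meets the factor U from the product
        rule; this is the numerator y + 1 in \<open>cutoff_slope\<close>.\<close>
      have 1: "real (Suc k) * U x = y k x + 1" by (simp add: y_def)
      have "U x * (flat_cutoff (y k x) / (y k x)\<^sup>2 * (real (Suc k) * (grad U x \<bullet> h)))
        = real (Suc k) * U x * (flat_cutoff (y k x) / (y k x)\<^sup>2) * (grad U x \<bullet> h)"
        by (simp only: mult_ac)
      then show ?thesis
        unfolding 1 cutoff_slope_def inner_scaleR_left divide_inverse
        by (simp only: distrib_left distrib_right mult_ac mult_1_left mult_1_right add_ac)
    qed
    ultimately show "(\<phi> k has_derivative (\<lambda>h. ((c * cutoff_slope (y k x)) *\<^sub>R grad U x) \<bullet> h)) (at x)"
      by (simp only:)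
  qed
  have Uc: "continuous_on UNIV U" using Ck[of 0] by simp
  have gUc: "continuous_on UNIV (grad U)" by (rule continuous_on_grad[OF Ck[of "Suc 0"]])
  have [measurable]: "U \<in> borel_measurable borel" "grad U \<in> borel_measurable borel"
    using Uc gUc by (auto intro: borel_measurable_continuous_onI)
  have c1: "continuous_on UNIV (\<phi> k)" and c2: "continuous_on UNIV (grad (\<phi> k))" for k
    using Ckphi[of 0 k] continuous_on_grad[OF Ckphi[of "Suc 0" k]] by auto
  have [measurable]: "\<phi> k \<in> borel_measurable borel" "grad (\<phi> k) \<in> borel_measurable borel" for k
    using c1 c2 by (auto intro: borel_measurable_continuous_onI)
  have ylim: "filterlim (\<lambda>k. y k x) at_top sequentially" for x
    unfolding y_def by (rule filterlim_cutoff_argument[OF pos])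
  have gdiff: "(norm (grad (\<phi> k) x - c *\<^sub>R grad U x))\<^sup>2
     = (cutoff_slope (y k x) - 1)\<^sup>2 * (c\<^sup>2 * (norm (grad U x))\<^sup>2)" for k x
  proof -
    have "grad (\<phi> k) x - c *\<^sub>R grad U x = ((cutoff_slope (y k x) - 1) * c) *\<^sub>R grad U x"
      by (simp add: gphi algebra_simps)
    then show ?thesis by (simp add: power_mult_distrib)
  qed
  have "(\<lambda>k. \<integral>\<^sup>+ x. ennreal ((norm (grad (\<phi> k) x - c *\<^sub>R grad U x))\<^sup>2) \<partial>lborel)
    \<longlonglongrightarrow> (\<integral>\<^sup>+ (x::real^'n). 0 \<partial>lborel)"
  proof (rule nn_integral_dominated_convergence[where w = "\<lambda>x. ennreal (c\<^sup>2) * ennreal ((norm (grad U x))\<^sup>2)"])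
    have "(\<integral>\<^sup>+x. ennreal (c\<^sup>2) * ennreal ((norm (grad U x))\<^sup>2) \<partial>lborel)
      = ennreal (c\<^sup>2) * (\<integral>\<^sup>+x. ennreal ((norm (grad U x))\<^sup>2) \<partial>lborel)"
      by (rule nn_integral_cmult) measurable
    then show "(\<integral>\<^sup>+x. ennreal (c\<^sup>2) * ennreal ((norm (grad U x))\<^sup>2) \<partial>lborel) < \<infinity>"
      using gU by (simp add: ennreal_mult_less_top)
    have "(cutoff_slope (y k x) - 1)\<^sup>2 \<le> 1" for k x
      using cutoff_slope_bounds[of "y k x"] by (simp add: abs_square_le_1 abs_le_iff)
    then have "(cutoff_slope (y k x) - 1)\<^sup>2 * (c\<^sup>2 * (norm (grad U x))\<^sup>2) \<le> c\<^sup>2 * (norm (grad U x))\<^sup>2" for k x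
      by (intro mult_left_le_one_le) auto
    then show "AE x in lborel. ennreal ((norm (grad (\<phi> k) x - c *\<^sub>R grad U x))\<^sup>2)
      \<le> ennreal (c\<^sup>2) * ennreal ((norm (grad U x))\<^sup>2)" for k
      unfolding gdiff by (intro AE_I2) (simp add: ennreal_leI flip: ennreal_mult')
    show "AE x in lborel. (\<lambda>k. ennreal ((norm (grad (\<phi> k) x - c *\<^sub>R grad U x))\<^sup>2)) \<longlonglongrightarrow> 0"
    proof (rule AE_I2)
      fix x
      have "(\<lambda>k. cutoff_slope (y k x)) \<longlonglongrightarrow> 1"
        by (rule filterlim_compose[OF cutoff_slope_tendsto_1 ylim])
      then have "(\<lambda>k. ennreal ((cutoff_slope (y k x) - 1)\<^sup>2 * (c\<^sup>2 * (norm (grad U x))\<^sup>2)))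
         \<longlonglongrightarrow> ennreal ((1 - 1)\<^sup>2 * (c\<^sup>2 * (norm (grad U x))\<^sup>2))"
        by (intro tendsto_ennrealI tendsto_intros)
      then show "(\<lambda>k. ennreal ((norm (grad (\<phi> k) x - c *\<^sub>R grad U x))\<^sup>2)) \<longlonglongrightarrow> 0"
        by (simp add: gdiff)
    qed
  qed measurable
  then have lim1: "(\<lambda>k. \<integral>\<^sup>+ x. ennreal ((norm (grad (\<phi> k) x - c *\<^sub>R grad U x))\<^sup>2) \<partial>lborel) \<longlonglongrightarrow> 0"
    by simp
  have fdiff: "\<bar>\<phi> k x - c * U x\<bar> = (1 - flat_cutoff (y k x)) * \<bar>c * U x\<bar>" for k x
  proof -
    have "\<phi> k x - c * U x = - ((1 - flat_cutoff (y k x)) * (c * U x))"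
      by (simp add: \<phi>_def algebra_simps)
    then show ?thesis using flat_cutoff_bounds[of "y k x"] by (simp add: abs_mult)
  qed
  have "(\<lambda>k. \<integral>\<^sup>+ x. ennreal (\<bar>\<phi> k x - c * U x\<bar> powr ?s) \<partial>lborel) \<longlonglongrightarrow> (\<integral>\<^sup>+ (x::real^'n). 0 \<partial>lborel)"
  proof (rule nn_integral_dominated_convergence[where w = "\<lambda>x. ennreal (\<bar>c * U x\<bar> powr ?s)"])
    have "(1 - flat_cutoff (y k x)) * \<bar>c * U x\<bar> \<le> \<bar>c * U x\<bar>" for k x
      using flat_cutoff_bounds[of "y k x"] by (intro mult_left_le_one_le) auto
    then show "AE x in lborel. ennreal (\<bar>\<phi> k x - c * U x\<bar> powr ?s) \<le> ennreal (\<bar>c * U x\<bar> powr ?s)" for k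
      unfolding fdiff using s flat_cutoff_bounds
      by (intro AE_I2 ennreal_leI powr_mono2) (auto intro!: mult_nonneg_nonneg)
    show "AE x in lborel. (\<lambda>k. ennreal (\<bar>\<phi> k x - c * U x\<bar> powr ?s)) \<longlonglongrightarrow> 0"
    proof (rule AE_I2)
      fix x
      have "(\<lambda>k. flat_cutoff (y k x)) \<longlonglongrightarrow> 1"
        by (rule filterlim_compose[OF flat_cutoff_tendsto_1 ylim])
      then have "(\<lambda>k. (1 - flat_cutoff (y k x)) * \<bar>c * U x\<bar>) \<longlonglongrightarrow> (1 - 1) * \<bar>c * U x\<bar>"
        by (intro tendsto_intros)
      then have lim: "(\<lambda>k. \<bar>\<phi> k x - c * U x\<bar>) \<longlonglongrightarrow> 0" by (simp add: fdiff)
      have "(\<lambda>k. \<bar>\<phi> k x - c * U x\<bar> powr ?s) \<longlonglongrightarrow> 0 powr ?s"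
        by (rule tendsto_powr'[OF lim tendsto_const]) (use s in auto)
      then show "(\<lambda>k. ennreal (\<bar>\<phi> k x - c * U x\<bar> powr ?s)) \<longlonglongrightarrow> 0"
        using tendsto_ennrealI by fastforce
    qed
  qed (use iU in measurable)
  then have lim2: "(\<lambda>k. \<integral>\<^sup>+ x. ennreal (\<bar>\<phi> k x - c * U x\<bar> powr ?s) \<partial>lborel) \<longlonglongrightarrow> 0" by simp
  show ?thesis
    unfolding D12_def using smooth lim1 lim2 by (intro conjI exI[of _ \<phi>]) auto
qed

lemma D12_bubble_profile:
  fixes \<xi> :: "real^'n"
  assumes n3: "CARD('n) \<ge> 3" and lam: "lam > 0"
  shows "D12 (\<lambda>x. c * bubble_profile \<xi> lam x) (\<lambda>x. c *\<^sub>R grad (bubble_profile \<xi> lam) x)"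
proof (rule D12_of_vanishing_at_infinity[OF n3])
  let ?a = "(real CARD('n) - 2) / 2"
  have a: "?a > 0" using n3 by simp
  fix \<epsilon> :: real assume eps: "\<epsilon> > 0"
  \<comment> \<open>Solving for the denominator: the profile exceeds \<open>\<epsilon>\<close> only
    where Q < K, that is, in a ball about \<open>\<xi>\<close>.\<close>
  define K where "K = lam / \<epsilon> powr (1 / ?a)"
  have "norm (x - \<xi>) \<le> sqrt (K / lam\<^sup>2)" if x: "bubble_profile \<xi> lam x > \<epsilon>" for x
  proof -
    have "\<epsilon> powr (1 / ?a) < bubble_profile \<xi> lam x powr (1 / ?a)"
      using x eps a by (intro powr_less_mono2) auto
    also have "\<dots> = lam / bden \<xi> lam x"
    proof -
      have "?a * (1 / ?a) = 1" using a by simp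
      then show ?thesis
        unfolding bubble_profile_def dimN_def bden_def[symmetric] powr_powr
        using lam bden_pos[of \<xi> lam x] by (simp only:) simp
    qed
    finally have "bden \<xi> lam x < K"
      using eps bden_pos[of \<xi> lam x] by (simp add: K_def field_simps)
    then have "(norm (x - \<xi>))\<^sup>2 \<le> K / lam\<^sup>2" using lam by (simp add: bden_def field_simps)
    then show ?thesis by (simp add: real_le_rsqrt)
  qed
  then have "{x. bubble_profile \<xi> lam x > \<epsilon>} \<subseteq> cball \<xi> (sqrt (K / lam\<^sup>2))"
    by (auto simp: dist_norm norm_minus_commute)
  then show "bounded {x. bubble_profile \<xi> lam x > \<epsilon>}" using bounded_subset bounded_cball by blast
qed (rule Ck_bubble_profile[OF lam] bubble_profile_pos[OF lam]
    nn_integral_grad_bubble_profile_finite[OF assms] nn_integral_bubble_profile_finite[OF assms])+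

section \<open>The Sobolev quotient and the final estimate\<close>

lemma S_HL_le:
  fixes u :: "real^'n \<Rightarrow> real"
  assumes "D12 u G"
  shows "S_HL TYPE('n) \<mu> * NL_energy \<mu> u powr (1 / hls_exp TYPE('n) \<mu>) \<le> (\<integral>x. (norm (G x))\<^sup>2 \<partial>lborel)"
proof (cases "NL_energy \<mu> u = 0")
  case False
  let ?E = "NL_energy \<mu> u powr (1 / hls_exp TYPE('n) \<mu>)"
  have E: "?E > 0" using False by simp
  \<comment> \<open>Every admissible constant is at most the quotient of this pair, hence so is the
    supremum; \<open>cSup_least\<close> asks for a nonempty set, and 0 is admissible. With zero
    energy there is no quotient, but then the left side of the claim is 0.\<close>
  have "S_HL TYPE('n) \<mu> \<le> (\<integral>x. (norm (G x))\<^sup>2 \<partial>lborel) / ?E"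
    unfolding S_HL_def
  proof (rule cSup_least)
    show "{S. \<forall>(u::real^'n \<Rightarrow> real) G. D12 u G \<longrightarrow>
       S * NL_energy \<mu> u powr (1 / hls_exp TYPE('n) \<mu>) \<le> (\<integral>x. (norm (G x))\<^sup>2 \<partial>lborel)} \<noteq> {}"
      by (auto intro!: exI[of _ 0])
  qed (use assms E in \<open>auto simp: pos_le_divide_eq\<close>)
  then show ?thesis using E by (simp add: pos_le_divide_eq)
qed simp

theorem theorem1p1:
  fixes \<mu> :: real
  assumes "CARD('n::finite) \<ge> 3" and "0 < \<mu>" and "\<mu> < real CARD('n)"
  shows "\<exists>K L. K > 0 \<and> L > 0 \<and>
    (\<forall>(u::real^'n \<Rightarrow> real) G v. D12 u G \<and> v \<in> M_tilde \<mu> \<and> NL_norm \<mu> u = NL_norm \<mu> v \<longrightarrow>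
       (\<integral>x. (norm (G x - grad v x))\<^sup>2 \<partial>lborel)
         \<le> K * delta_tilde \<mu> u G + L * NL_norm \<mu> u * NL_norm \<mu> (\<lambda>x. u x - v x))"
proof -
  let ?n = "real CARD('n)"
  have n: "?n \<ge> 3" using assms(1) by simp
  obtain C1 where C1: "C1 > 0" and pair: "\<And>(w :: real^'n \<Rightarrow> real) \<xi> lam. lam > 0 \<Longrightarrow>
    w \<in> borel_measurable borel \<Longrightarrow> NL_integral \<mu> w < \<infinity> \<Longrightarrow>
    (\<integral>\<^sup>+x. ennreal (\<bar>w x\<bar> * bden \<xi> lam x powr (- (?n + 2) / 2)) \<partial>lborel)
      \<le> ennreal (C1 * lam powr (- (?n + 2) / 2) * NL_norm \<mu> w)"
    using weighted_integral_le_NL_norm[OF assms] by blast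
  obtain C2 where C2: "C2 > 0" and coeff: "\<And>c (\<xi> :: real^'n) lam. lam > 0 \<Longrightarrow>
    NL_integral \<mu> (\<lambda>x. c * bubble_profile \<xi> lam x) < \<infinity> \<Longrightarrow>
    \<bar>c\<bar> \<le> C2 * NL_norm \<mu> (\<lambda>x. c * bubble_profile \<xi> lam x)"
    using NL_norm_bubble_lower_bound[OF assms] by blast
  \<comment> \<open>The numerical constant in the Laplacian of the bubble.\<close>
  define A where "A = ?n * (?n - 2)"
  have A: "A > 0" using n by (simp add: A_def)
  \<comment> \<open>The 2 is that of the cross term, \<open>C2\<close> bounds the coefficient by the
    norm of u, and \<open>A * C1\<close> bounds the pairing of u - v with the Laplacian.\<close>
  define L where "L = 2 * C2 * A * C1"
  have main: "(\<integral>x. (norm (G x - grad v x))\<^sup>2 \<partial>lborel)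
      \<le> 1 * delta_tilde \<mu> u G + L * NL_norm \<mu> u * NL_norm \<mu> (\<lambda>x. u x - v x)"
    if D: "D12 u G" and v: "v \<in> M_tilde \<mu>" and eq: "NL_norm \<mu> u = NL_norm \<mu> v"
    for u v :: "real^'n \<Rightarrow> real" and G
  proof -
    obtain c0 \<xi> lam where lam: "lam > 0" and v0: "v = (\<lambda>x. c0 * W \<mu> \<xi> lam x)"
      using v by (auto simp: M_tilde_def)
    \<comment> \<open>The coefficient of the bare profile, normalization included;
      \<open>coeff\<close> bounds this product as a whole.\<close>
    define c where "c = c0 * c_Nmu TYPE('n) \<mu>"
    define U where "U = bubble_profile \<xi> lam"
    have v: "v = (\<lambda>x. c * U x)" by (simp add: v0 W_def c_def U_def mult.assoc)
    have U: "Ck k U" for k using Ck_bubble_profile[OF lam] by (simp add: U_def)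
    have gv: "grad v x = c *\<^sub>R grad U x" for x unfolding v by (rule grad_scale[OF U])
    have Dv: "D12 v (\<lambda>x. c *\<^sub>R grad U x)"
      unfolding v U_def by (rule D12_bubble_profile[OF assms(1) lam])
    have gU: "(\<integral>\<^sup>+x. ennreal ((norm (grad U x))\<^sup>2) \<partial>lborel) < \<infinity>"
      unfolding U_def by (rule nn_integral_grad_bubble_profile_finite[OF assms(1) lam])
    have lU: "(\<integral>\<^sup>+x. ennreal (\<bar>laplacian U x\<bar> powr (2 * ?n / (?n + 2))) \<partial>lborel) < \<infinity>"
      unfolding U_def by (rule nn_integral_laplacian_bubble_profile_finite[OF assms(1) lam])
    note Gu = Green_D12[OF D assms(1) U gU lU] and Gv = Green_D12[OF Dv assms(1) U gU lU]
    have um [measurable]: "u \<in> borel_measurable borel" "G \<in> borel_measurable borel"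
      using D by (auto simp: D12_def)
    have vm [measurable]: "v \<in> borel_measurable borel" "(\<lambda>x. c *\<^sub>R grad U x) \<in> borel_measurable borel"
      using Dv by (auto simp: D12_def)
    have [measurable]: "grad U \<in> borel_measurable borel"
      using continuous_on_grad[OF U[of "Suc 0"]] by (rule borel_measurable_continuous_onI)
    define w where "w x = u x - v x" for x
    have [measurable]: "w \<in> borel_measurable borel" unfolding w_def by measurable
    have s: "sob_exp TYPE('n) > 0" using n by (simp add: sob_exp_def dimN_def)
    note iu = D12_nn_integral_finite[OF D assms(1)] and iv = D12_nn_integral_finite[OF Dv assms(1)]
    \<comment> \<open>Both u and v lie in the Sobolev space of exponent 2n/(n - 2), hence so does
      their difference, and its \<open>NL_norm\<close> is that of a finite energy.\<close>
    have "(\<integral>\<^sup>+x. ennreal (\<bar>u x + - v x\<bar> powr sob_exp TYPE('n)) \<partial>lborel) < \<infinity>"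
      using iu(1) iv(1) s by (intro nn_integral_powr_add_finite) auto
    then have wfin: "NL_integral \<mu> w < \<infinity>"
      by (intro NL_integral_finite assms) (auto simp: w_def)
    have vfin: "NL_integral \<mu> v < \<infinity>"
      by (intro NL_integral_finite assms iv(1)) auto
    have c: "\<bar>c\<bar> \<le> C2 * NL_norm \<mu> u"
      using coeff[OF lam, of c \<xi>] vfin unfolding eq v U_def by simp
    have iG: "integrable lborel (\<lambda>x. (norm (G x))\<^sup>2)"
      using iu(2) by (intro integrableI_bounded) auto
    have iU: "integrable lborel (\<lambda>x. (norm (grad U x))\<^sup>2)"
      using gU by (intro integrableI_bounded) auto
    define a where "a = (\<integral>x. (norm (G x))\<^sup>2 \<partial>lborel)"
    define b where "b = (\<integral>x. G x \<bullet> grad U x \<partial>lborel)"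
    define d where "d = (\<integral>x. (norm (grad U x))\<^sup>2 \<partial>lborel)"
    have "(norm (G x - grad v x))\<^sup>2 = (norm (G x))\<^sup>2 - 2 * c * (G x \<bullet> grad U x) + c\<^sup>2 * (norm (grad U x))\<^sup>2" for x
      unfolding gv power2_norm_eq_inner
      by (simp add: inner_diff_left inner_diff_right inner_commute[of "grad U x" "G x"] algebra_simps power2_eq_square)
    then have expand: "(\<integral>x. (norm (G x - grad v x))\<^sup>2 \<partial>lborel) = a - 2 * c * b + c\<^sup>2 * d"
      using iG iU Gu(1) by (simp add: a_def b_def d_def)
    \<comment> \<open>Green's identity is used for u and for v separately and subtracted at the
      level of integrals, which spares the construction of an approximating sequence for u -
      v.\<close>
    have cd: "c * d = - (\<integral>x. v x * laplacian U x \<partial>lborel)"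
      using Gv(3) by (simp add: d_def power2_norm_eq_inner)
    have bcd: "b - c * d = - (\<integral>x. w x * laplacian U x \<partial>lborel)"
      unfolding cd b_def Gu(3) w_def using Gu(2) Gv(2) by (simp add: left_diff_distrib)
    have bound: "\<bar>b - c * d\<bar> \<le> A * C1 * NL_norm \<mu> w"
    proof -
      have lap: "\<bar>w x * laplacian U x\<bar> = A * lam powr ((?n + 2) / 2) * (\<bar>w x\<bar> * bden \<xi> lam x powr (- (?n + 2) / 2))" for x
        using n by (simp add: U_def laplacian_bubble_profile[OF lam] abs_mult A_def)
      have "ennreal \<bar>b - c * d\<bar> \<le> (\<integral>\<^sup>+x. ennreal \<bar>w x * laplacian U x\<bar> \<partial>lborel)"
      proof -
        have "integrable lborel (\<lambda>x. w x * laplacian U x)"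
          using Gu(2) Gv(2) by (simp add: w_def left_diff_distrib)
        from integral_norm_bound_ennreal[OF this] show ?thesis
          unfolding bcd by (simp only: abs_minus_cancel real_norm_def)
      qed
      also have "\<dots> = (\<integral>\<^sup>+x. ennreal (A * lam powr ((?n + 2) / 2))
          * ennreal (\<bar>w x\<bar> * bden \<xi> lam x powr (- (?n + 2) / 2)) \<partial>lborel)"
        unfolding lap using A by (intro nn_integral_cong ennreal_mult') auto
      also have "\<dots> = ennreal (A * lam powr ((?n + 2) / 2)) *
         (\<integral>\<^sup>+x. ennreal (\<bar>w x\<bar> * bden \<xi> lam x powr (- (?n + 2) / 2)) \<partial>lborel)"
        by (rule nn_integral_cmult) measurable
      also have "\<dots> \<le> ennreal (A * lam powr ((?n + 2) / 2)) * ennreal (C1 * lam powr (- (?n + 2) / 2) * NL_norm \<mu> w)"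
        by (intro mult_left_mono pair[OF lam _ wfin]) auto
      also have "\<dots> = ennreal (A * lam powr ((?n + 2) / 2) * (C1 * lam powr (- (?n + 2) / 2) * NL_norm \<mu> w))"
        using A by (intro ennreal_mult'[symmetric]) auto
      also have "A * lam powr ((?n + 2) / 2) * (C1 * lam powr (- (?n + 2) / 2) * NL_norm \<mu> w)
         = (lam powr ((?n + 2) / 2) * lam powr (- (?n + 2) / 2)) * (A * C1 * NL_norm \<mu> w)"
        by (simp only: mult_ac)
      \<comment> \<open>Here the scale disappears and the constant becomes uniform over all
        bubbles.\<close>
      also have "lam powr ((?n + 2) / 2) * lam powr (- (?n + 2) / 2) = 1"
      proof -
        have "(?n + 2) / 2 + - (?n + 2) / 2 = 0" by (simp add: field_simps)
        then show ?thesis using lam by (simp only: powr_add[symmetric]) simp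
      qed
      finally show ?thesis using A C1 NL_norm_nonneg[of \<mu> w] by simp
    qed
    have S: "S_HL TYPE('n) \<mu> * NL_energy \<mu> u powr (1 / hls_exp TYPE('n) \<mu>) \<le> c\<^sup>2 * d"
      using S_HL_le[OF Dv, of \<mu>] unfolding NL_norm_square[symmetric] eq
      by (simp add: d_def power_mult_distrib)
    have "- (2 * c * (b - c * d)) \<le> 2 * (\<bar>c\<bar> * \<bar>b - c * d\<bar>)"
      by (metis (no_types, opaque_lifting) abs_ge_minus_self abs_mult abs_numeral mult.assoc)
    also have "\<dots> \<le> 2 * ((C2 * NL_norm \<mu> u) * (A * C1 * NL_norm \<mu> w))"
      using c bound C2 NL_norm_nonneg[of \<mu> u] by (intro mult_left_mono mult_mono) auto
    finally have "- (2 * c * (b - c * d)) \<le> L * NL_norm \<mu> u * NL_norm \<mu> w"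
      by (simp add: L_def mult_ac)
    then have "(a - c\<^sup>2 * d) + - (2 * c * (b - c * d)) \<le>
        (a - S_HL TYPE('n) \<mu> * NL_energy \<mu> u powr (1 / hls_exp TYPE('n) \<mu>)) + L * NL_norm \<mu> u * NL_norm \<mu> w"
      by (intro add_mono diff_left_mono S)
    moreover have "a - 2 * c * b + c\<^sup>2 * d = (a - c\<^sup>2 * d) + - (2 * c * (b - c * d))"
      by (simp add: algebra_simps power2_eq_square)
    ultimately show ?thesis
      unfolding expand delta_tilde_def a_def[symmetric] w_def[abs_def] by (simp only: mult_1_left)
  qed
  have "L > 0" using C1 C2 A by (simp add: L_def)
  show ?thesis
    by (rule exI[of _ "1::real"], rule exI[of _ L]) (use \<open>L > 0\<close> main in auto)
qed

end
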